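(* Let $\mathcal{A}$ be a finite alphabet and let $\eta\colon\mathbb{Z}^2\to\mathcal{A}$. Suppose there is an infinite sequence of (pairwise distinct) pairs $(n_i,k_i)$ of positive integers such that $P_\eta(n_i,k_i)\le n_ik_i$ for all $i$. Then $\eta$ has zero directional entropy along each of its nonexpansive directions; that is, $h(\mathbf{u})=0$ for every unit vector $\mathbf{u}\in\mathbb{R}^2$ such that the line $\mathbb{R}\mathbf{u}$ is nonexpansive for $X_\eta$.
   Context: For $\mathbf{n}\in\mathbb{Z}^2$ and $x\colon\mathbb{Z}^2\to\mathcal{A}$, define $T^{\mathbf{n}}x\colon\mathbb{Z}^2\to\mathcal{A}$ by $(T^{\mathbf{n}}x)(\mathbf{m})=x(\mathbf{m}+\mathbf{n})$. For bounded $K\subset\mathbb{R}^2$, $P_\eta(K)=|\{(T^{\mathbf{n}}\eta)|_{K\cap\mathbb{Z}^2}:\mathbf{n}\in\mathbb{Z}^2\}|$, and $P_\eta(n,k)=P_\eta([0,n-1]\times[0,k-1])$. Give $\mathcal{A}$ the discrete topology and $\mathcal{A}^{\mathbb{Z}^2}$ the product topology, and let $X_\eta$ be the closure of $\{T^{\mathbf{n}}\eta:\mathbf{n}\in\mathbb{Z}^2\}$, with the $\mathbb{Z}^2$ action $T=(T^{\mathbf{n}})$ by translations and the metric $\rho(x,y)=2^{-\min\{\|\mathbf{m}\|:x(\mathbf{m})\ne y(\mathbf{m})\}}$ for $x\neq y$, $\rho(x,x)=0$ ($\|\cdot\|$ the Euclidean norm). Directional entropy: for bounded $E\subset\mathbb{R}^2$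 and $\varepsilon>0$, $N_T(E,\varepsilon)$ is the minimal cardinality of a set $Y\subset X_\eta$ such that for each $x\in X_\eta$ there is $y\in Y$ with $\rho(T^{\mathbf{n}}x,T^{\mathbf{n}}y)<\varepsilon$ for every $\mathbf{n}\in E\cap\mathbb{Z}^2$. For $t>0$, $E^{(t)}=\{\mathbf{v}\in\mathbb{R}^2:\|\mathbf{v}-\mathbf{w}\|<t\text{ for some }\mathbf{w}\in E\}$. For a unit vector $\mathbf{u}\in\mathbb{R}^2$ and $s>0$, $[0,s\mathbf{u}]=\{rs\mathbf{u}:0\le r\le1\}$. The (one-dimensional) topological directional entropy of the action $T$ on $X_\eta$ in direction $\mathbf{u}$ is $$h(\mathbf{u})=\lim_{\varepsilon\to0}\ \sup_{t>0}\ \limsup_{s\to\infty}\frac{\log N_T([0,s\mathbf{u}]^{(t)},\varepsilon)}{s}\in[0,\infty].$$ Expansiveness: a line $\ell\subset\mathbb{R}^2$ is expansive (for $X_\eta$) if there is $r>0$ such that whenever $x,y\in X_\eta$ satisfy $x(\mathbf{n})=y(\mathbf{n})$ for all $\mathbf{n}\in\mathbb{Z}^2$ at Euclidean distance less than $r$ from $\ell$, then $x=y$; otherwise $\ell$ is nonexpansive. *)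

theory Defs
  imports "HOL-Analysis.Analysis"
begin

text \<open>The plane is \<^typ>\<open>real \<times> real\<close>, whose \<^const>\<open>norm\<close> is the Euclidean norm; the lattice is
  \<^typ>\<open>int \<times> int\<close> with componentwise addition.\<close>

definition lattice_point :: "int \<times> int \<Rightarrow> real \<times> real" where
  "lattice_point m = (of_int (fst m), of_int (snd m))"

definition translate :: "int \<times> int \<Rightarrow> (int \<times> int \<Rightarrow> 'a) \<Rightarrow> (int \<times> int \<Rightarrow> 'a)" where
  "translate n x = (\<lambda>m. x (m + n))"

text \<open>The sets counted below are finite when the alphabet is finite and \<open>K\<close> is bounded.\<close>

definition pattern_complexity :: "(int \<times> int \<Rightarrow> 'a) \<Rightarrow> (real \<times> real) set \<Rightarrow> nat" where
  "pattern_complexity \<eta> K = card (range (\<lambda>n. restrict (translate n \<eta>) (lattice_point -` K)))"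

definition rect_complexity :: "(int \<times> int \<Rightarrow> 'a) \<Rightarrow> nat \<Rightarrow> nat \<Rightarrow> nat" where
  "rect_complexity \<eta> n k = pattern_complexity \<eta> ({0..real n - 1} \<times> {0..real k - 1})"

definition orbit_closure :: "(int \<times> int \<Rightarrow> 'a) \<Rightarrow> (int \<times> int \<Rightarrow> 'a) set" where
  "orbit_closure \<eta> =
     product_topology (\<lambda>_. discrete_topology UNIV) UNIV closure_of range (\<lambda>n. translate n \<eta>)"

text \<open>For \<open>x \<noteq> y\<close> the infimum is a minimum, since each disc contains finitely many lattice points.\<close>

definition config_dist :: "(int \<times> int \<Rightarrow> 'a) \<Rightarrow> (int \<times> int \<Rightarrow> 'a) \<Rightarrow> real" where
  "config_dist x y =
     (if x = y then 0 else 2 powr - (INF m \<in> {m. x m \<noteq> y m}. norm (lattice_point m)))"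

definition spanning_set ::
  "(int \<times> int \<Rightarrow> 'a) set \<Rightarrow> (real \<times> real) set \<Rightarrow> real \<Rightarrow> (int \<times> int \<Rightarrow> 'a) set \<Rightarrow> bool" where
  "spanning_set X E \<epsilon> Y \<longleftrightarrow> Y \<subseteq> X \<and>
     (\<forall>x\<in>X. \<exists>y\<in>Y. \<forall>n. lattice_point n \<in> E \<longrightarrow> config_dist (translate n x) (translate n y) < \<epsilon>)"

text \<open>Over a finite alphabet, with \<open>E\<close> bounded and \<open>\<epsilon> > 0\<close>, the condition on \<open>x\<close> and \<open>y\<close> in
  \<^const>\<open>spanning_set\<close> holds once they agree on a suitable finite set of lattice points, so a finite
  spanning set exists. Finiteness of \<open>Y\<close> is required because \<^const>\<open>card\<close> is 0 on infinite sets.\<close>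

definition spanning_number ::
  "(int \<times> int \<Rightarrow> 'a) set \<Rightarrow> (real \<times> real) set \<Rightarrow> real \<Rightarrow> nat" where
  "spanning_number X E \<epsilon> = (LEAST c. \<exists>Y. spanning_set X E \<epsilon> Y \<and> finite Y \<and> card Y = c)"

definition thicken :: "real \<Rightarrow> (real \<times> real) set \<Rightarrow> (real \<times> real) set" where
  "thicken t E = {v. \<exists>w\<in>E. norm (v - w) < t}"

text \<open>The function of \<open>\<epsilon>\<close> below increases as \<open>\<epsilon>\<close> decreases to 0, so the limit exists in \<^typ>\<open>ereal\<close>.\<close>

definition directional_entropy :: "(int \<times> int \<Rightarrow> 'a) set \<Rightarrow> real \<times> real \<Rightarrow> ereal" where
  "directional_entropy X u =
     Lim (at_right 0) (\<lambda>\<epsilon>::real. SUP t\<in>{0<..}. Limsup at_top (\<lambda>s::real.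
       ereal (ln (real (spanning_number X (thicken t (closed_segment 0 (s *\<^sub>R u))) \<epsilon>)) / s)))"

definition expansive_line :: "(int \<times> int \<Rightarrow> 'a) set \<Rightarrow> (real \<times> real) set \<Rightarrow> bool" where
  "expansive_line X l \<longleftrightarrow> (\<exists>r>0. \<forall>x\<in>X. \<forall>y\<in>X.
     (\<forall>n. infdist (lattice_point n) l < r \<longrightarrow> x n = y n) \<longrightarrow> x = y)"

end

theory Submission
  imports Defs "HOL-Real_Asymp.Real_Asymp"
begin

text \<open>The argument shows that \<open>\<eta>\<close> either has a nonzero period or shows at most polynomially many patterns
on \<open>m \<times> m\<close> squares for infinitely many \<open>m\<close> (\<open>periodic_or_polynomial_squares\<close>).

In the second case the entropy vanishes in every direction: a strip of length \<open>s\<close> around a segment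
is covered by about \<open>2 s / m\<close> such squares, so the logarithm of its number of patterns is at most
a constant times \<open>s log m / m\<close>. In the first case every line that is transversal to the period
is expansive, because the period carries each lattice point close to the line. A nonexpansive
direction is therefore parallel to the period, and the number of patterns along it is bounded.

The dichotomy rests on the Morse--Hedlund argument. By symmetry, suppose that \<open>k\<^sub>i \<le> n\<^sub>i\<close>
infinitely often, and let \<open>N \<times> k\<close> be a rectangle of least height among these. Its low complexity gives
a height \<open>q < k\<close> at which passing from \<open>N \<times> q\<close> to \<open>N \<times> (q + 1)\<close> creates fewer than \<open>N\<close> new
patterns. Hence fewer than \<open>N\<close> patterns on \<open>N \<times> q\<close> leave the adjacent row open. A horizontal
strip of height \<open>q\<close> that fails to determine the row above it, or the one below it, shows only such
patterns, hence fewer than \<open>N\<close> windows of length \<open>N\<close>, and is horizontally periodic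
(\<open>periodic_or_row_determined\<close>). Moreover one fixed number \<open>Q\<close> is such that horizontal
\<open>Q\<close>-periodicity passes from a strip to the adjacent rows (\<open>row_periodic\<close>). Read backwards, a
place where \<open>Q\<close>-periodicity breaks persists, with bounded displacement per row, in the strips
above and below, and all these strips determine their neighbours. So a single strip with a break
near its middle determines a rectangle of width and height proportional to its own width
(\<open>agree_on_cone\<close>).

If \<open>\<eta>\<close> is not \<open>Q\<close>-periodic, then every \<open>m \<times> m\<close> pattern also occurs at a place with a break
nearby: inside a region without breaks one may shift by multiples of \<open>Q\<close> until the nearest break
is close (\<open>ex_nearby_break\<close>). The pattern is then determined by the position of the break and by a
pattern on an \<open>n \<times> q\<close> strip with \<open>n\<close> proportional to \<open>m\<close>. For \<open>n = n\<^sub>i\<close> there are at most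
\<open>n\<^sub>i k\<^sub>i \<le> n\<^sub>i\<^sup>2\<close> of these, which is polynomial in \<open>m\<close> (\<open>square_patterns_le\<close>).

All counting concerns the translates of \<open>\<eta>\<close>. The orbit closure enters only because it
contains them and because its elements agree with them on finite sets (\<open>orbit_closure_approx\<close>).\<close>

section \<open>Patterns and their number\<close>

definition orbit :: "(int \<times> int \<Rightarrow> 'a) \<Rightarrow> (int \<times> int \<Rightarrow> 'a) set" where
  "orbit \<eta> = range (\<lambda>v. translate v \<eta>)"

definition patterns :: "(int \<times> int \<Rightarrow> 'a) \<Rightarrow> (int \<times> int) set \<Rightarrow> (int \<times> int \<Rightarrow> 'a) set" where
  "patterns \<eta> S = (\<lambda>x. restrict x S) ` orbit \<eta>"

definition agree :: "'b set \<Rightarrow> ('b \<Rightarrow> 'a) \<Rightarrow> ('b \<Rightarrow> 'a) \<Rightarrow> bool" where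
  "agree S x y \<longleftrightarrow> (\<forall>z\<in>S. x z = y z)"

lemma pattern_complexity_eq_card_patterns:
  "pattern_complexity \<eta> K = card (patterns \<eta> (lattice_point -` K))"
  by (simp add: pattern_complexity_def patterns_def orbit_def image_image)

lemma restrict_eq_iff_agree: "restrict x S = restrict y S \<longleftrightarrow> agree S x y"
  unfolding agree_def restrict_def by (metis (no_types, lifting))

lemma agree_sym: "agree S x y \<Longrightarrow> agree S y x"
  by (simp add: agree_def)

lemma agree_trans: "agree S x y \<Longrightarrow> agree S y z \<Longrightarrow> agree S x z"
  by (simp add: agree_def)

lemma agree_subset: "agree S x y \<Longrightarrow> T \<subseteq> S \<Longrightarrow> agree T x y"
  by (auto simp: agree_def)

lemma agree_Un: "agree (S \<union> T) x y \<longleftrightarrow> agree S x y \<and> agree T x y"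
  by (auto simp: agree_def)

lemma translate_apply [simp]: "translate v x z = x (z + v)"
  by (simp add: translate_def)

lemma translate_translate: "translate v (translate w x) = translate (v + w) x"
  by (auto simp: fun_eq_iff algebra_simps)

lemma self_in_orbit: "\<eta> \<in> orbit \<eta>"
proof -
  have "translate 0 \<eta> = \<eta>" by (auto simp: fun_eq_iff)
  then show ?thesis unfolding orbit_def by (metis rangeI)
qed

lemma translate_in_orbit: "x \<in> orbit \<eta> \<Longrightarrow> translate v x \<in> orbit \<eta>"
  by (auto simp: orbit_def translate_translate)

lemma finite_patterns:
  fixes \<eta> :: "int \<times> int \<Rightarrow> 'a::finite"
  assumes "finite S"
  shows "finite (patterns \<eta> S)"
proof (rule finite_subset)
  show "patterns \<eta> S \<subseteq> (\<Pi>\<^sub>E z\<in>S. UNIV)"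
    by (auto simp: patterns_def)
qed (simp add: assms finite_PiE)

lemma card_patterns_pos:
  fixes \<eta> :: "int \<times> int \<Rightarrow> 'a::finite"
  assumes "finite S"
  shows "0 < card (patterns \<eta> S)"
  using finite_patterns[OF assms, of \<eta>] self_in_orbit[of \<eta>]
  by (auto simp: card_gt_0_iff patterns_def)

text \<open>Labelling is a relation and not a function because a configuration may fit several labels, as in
  the later count by nearby breaks of periodicity.\<close>

lemma card_patterns_le_labels:
  assumes "finite J"
    and "\<And>x. x \<in> orbit \<eta> \<Longrightarrow> \<exists>l\<in>J. lab x l"
    and "\<And>x y l. \<lbrakk>x \<in> orbit \<eta>; y \<in> orbit \<eta>; l \<in> J; lab x l; lab y l\<rbrakk> \<Longrightarrow> agree S x y"
  shows "card (patterns \<eta> S) \<le> card J"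
proof -
  define g where "g l = restrict (SOME x. x \<in> orbit \<eta> \<and> lab x l) S" for l
  have "patterns \<eta> S \<subseteq> g ` J"
  proof
    fix w assume "w \<in> patterns \<eta> S"
    then obtain x where x: "x \<in> orbit \<eta>" and w: "w = restrict x S" by (auto simp: patterns_def)
    obtain l where l: "l \<in> J" "lab x l" using assms(2)[OF x] by blast
    let ?y = "SOME x. x \<in> orbit \<eta> \<and> lab x l"
    have "?y \<in> orbit \<eta> \<and> lab ?y l" by (rule someI[of _ x]) (simp add: x l)
    then have "agree S x ?y" using assms(3) x l by blast
    then have "w = g l" by (simp add: w g_def restrict_eq_iff_agree)
    with l show "w \<in> g ` J" by blast
  qed
  then show ?thesis
    by (meson assms(1) card_image_le card_mono finite_imageI le_trans)
qed

lemma card_patterns_le: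
  fixes \<eta> :: "int \<times> int \<Rightarrow> 'a::finite"
  assumes "finite T"
    and "\<And>x y. \<lbrakk>x \<in> orbit \<eta>; y \<in> orbit \<eta>; agree T x y\<rbrakk> \<Longrightarrow> agree S x y"
  shows "card (patterns \<eta> S) \<le> card (patterns \<eta> T)"
proof (rule card_patterns_le_labels)
  show "finite (patterns \<eta> T)" by (rule finite_patterns) fact
  show "\<exists>l\<in>patterns \<eta> T. restrict x T = l" if "x \<in> orbit \<eta>" for x
    using that by (auto simp: patterns_def)
  show "agree S x y" if "x \<in> orbit \<eta>" "y \<in> orbit \<eta>" "restrict x T = l" "restrict y T = l" for x y l
    using assms(2) that restrict_eq_iff_agree by metis
qed

lemma card_patterns_mono:
  fixes \<eta> :: "int \<times> int \<Rightarrow> 'a::finite"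
  assumes "S \<subseteq> T" "finite T"
  shows "card (patterns \<eta> S) \<le> card (patterns \<eta> T)"
  using assms by (intro card_patterns_le) (auto simp: agree_def)

lemma card_patterns_Un_le:
  fixes \<eta> :: "int \<times> int \<Rightarrow> 'a::finite"
  assumes "finite S" "finite T"
  shows "card (patterns \<eta> (S \<union> T)) \<le> card (patterns \<eta> S) * card (patterns \<eta> T)"
proof -
  have "card (patterns \<eta> (S \<union> T)) \<le> card (patterns \<eta> S \<times> patterns \<eta> T)"
  proof (rule card_patterns_le_labels)
    show "finite (patterns \<eta> S \<times> patterns \<eta> T)" by (simp add: finite_patterns assms)
    show "\<exists>l\<in>patterns \<eta> S \<times> patterns \<eta> T. (restrict x S, restrict x T) = l" if "x \<in> orbit \<eta>" for x
      using that by (auto simp: patterns_def)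
    show "agree (S \<union> T) x y"
      if "(restrict x S, restrict x T) = l" "(restrict y S, restrict y T) = l" for x y l
      using that by (metis agree_Un old.prod.inject restrict_eq_iff_agree)
  qed
  then show ?thesis by (simp add: card_cartesian_product)
qed

lemma card_patterns_translate_le:
  fixes \<eta> :: "int \<times> int \<Rightarrow> 'a::finite"
  assumes "finite S"
  shows "card (patterns \<eta> ((\<lambda>z. z + v) ` S)) \<le> card (patterns \<eta> S)"
proof (rule card_patterns_le_labels)
  show "finite (patterns \<eta> S)" by (rule finite_patterns) fact
  show "\<exists>l\<in>patterns \<eta> S. restrict (translate v x) S = l" if "x \<in> orbit \<eta>" for x
    using translate_in_orbit[OF that] by (auto simp: patterns_def)
  show "agree ((\<lambda>z. z + v) ` S) x y"
    if "restrict (translate v x) S = l" "restrict (translate v y) S = l" for x y l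
    using that restrict_eq_iff_agree[of "translate v x" S "translate v y"]
    by (simp add: agree_def)
qed

lemma card_patterns_UN_le:
  fixes \<eta> :: "int \<times> int \<Rightarrow> 'a::finite"
  assumes "finite J" and "\<And>j. j \<in> J \<Longrightarrow> finite (S j)"
    and "\<And>j. j \<in> J \<Longrightarrow> card (patterns \<eta> (S j)) \<le> D"
  shows "card (patterns \<eta> (\<Union>j\<in>J. S j)) \<le> D ^ card J"
  using assms
proof (induction J rule: finite_induct)
  case empty
  have "patterns \<eta> {} = {restrict \<eta> {}}"
    using self_in_orbit[of \<eta>] by (auto simp: patterns_def)
  then show ?case by simp
next
  case (insert j J)
  have "card (patterns \<eta> (S j \<union> (\<Union>j\<in>J. S j)))
      \<le> card (patterns \<eta> (S j)) * card (patterns \<eta> (\<Union>j\<in>J. S j))"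
    by (rule card_patterns_Un_le) (use insert in auto)
  also have "\<dots> \<le> D * D ^ card J"
    by (rule mult_mono) (use insert in auto)
  finally show ?case using insert by simp
qed

text \<open>Restriction maps the patterns on \<open>T\<close> onto those on \<open>S\<close>. When there are no more of the former it is
a bijection, so that a pattern on \<open>S\<close> extends to \<open>T\<close> in only one way.\<close>

lemma determined_of_card_le:
  fixes \<eta> :: "int \<times> int \<Rightarrow> 'a::finite"
  assumes "finite T" "S \<subseteq> T" and le: "card (patterns \<eta> T) \<le> card (patterns \<eta> S)"
    and "x \<in> orbit \<eta>" "y \<in> orbit \<eta>" "agree S x y"
  shows "agree T x y"
proof -
  have im: "(\<lambda>w. restrict w S) ` patterns \<eta> T = patterns \<eta> S"
    using assms(2) by (simp add: patterns_def image_image restrict_restrict Int_absorb1)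
  have "card ((\<lambda>w. restrict w S) ` patterns \<eta> T) = card (patterns \<eta> T)"
    using card_patterns_mono[OF assms(2,1), of \<eta>] le im by simp
  then have inj: "inj_on (\<lambda>w. restrict w S) (patterns \<eta> T)"
    by (rule eq_card_imp_inj_on[OF finite_patterns[OF assms(1)]])
  have "restrict (restrict x T) S = restrict (restrict y T) S"
    using assms(2,6) by (simp add: restrict_restrict Int_absorb1 restrict_eq_iff_agree)
  moreover have "restrict x T \<in> patterns \<eta> T" "restrict y T \<in> patterns \<eta> T"
    using assms(4,5) by (simp_all add: patterns_def)
  ultimately have "restrict x T = restrict y T" by (rule inj_onD[OF inj])
  then show ?thesis by (simp add: restrict_eq_iff_agree)
qed

lemma card_image_ge_of_fibres:
  assumes "finite X" "B \<subseteq> f ` X"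
    and two: "\<And>b. b \<in> B \<Longrightarrow> \<exists>x\<in>X. \<exists>y\<in>X. x \<noteq> y \<and> f x = b \<and> f y = b"
  shows "card (f ` X) + card B \<le> card X"
proof -
  define g where "g b = (SOME x. x \<in> X \<and> f x = b)" for b
  have g: "g b \<in> X \<and> f (g b) = b" if b: "b \<in> f ` X" for b
  proof -
    obtain x where "x \<in> X \<and> f x = b" using b by auto
    then show ?thesis unfolding g_def by (rule someI)
  qed
  have inj: "inj_on g (f ` X)" using g by (metis inj_onI)
  have sub: "B \<subseteq> f ` (X - g ` f ` X)"
  proof
    fix b assume "b \<in> B"
    then obtain x y where xy: "x \<in> X" "y \<in> X" "x \<noteq> y" "f x = b" "f y = b" using two by blast
    obtain z where z: "z \<in> X" "f z = b" "z \<noteq> g b" using xy by metis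
    have "z \<notin> g ` f ` X" using z g by (metis imageE)
    then show "b \<in> f ` (X - g ` f ` X)" using z by blast
  qed
  have "card B \<le> card (X - g ` f ` X)"
    using assms(1) sub by (meson card_image_le card_mono finite_Diff finite_imageI le_trans)
  moreover have "card (X - g ` f ` X) = card X - card (f ` X)"
    using g inj assms(1) by (subst card_Diff_subset) (auto simp: card_image)
  moreover have "card (f ` X) \<le> card X" by (rule card_image_le[OF assms(1)])
  ultimately show ?thesis by linarith
qed

text \<open>Restriction from \<open>T\<close> to \<open>S\<close> is onto, and the fibre over each pattern that extends in several ways
has at least two elements; so each such pattern contributes to the excess of patterns on \<open>T\<close>.\<close>

lemma card_ambiguous_less:
  fixes \<eta> :: "int \<times> int \<Rightarrow> 'a::finite"
  assumes "finite T" "S \<subseteq> T" and "card (patterns \<eta> T) < card (patterns \<eta> S) + N"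
  shows "card {restrict x S | x. x \<in> orbit \<eta> \<and> (\<exists>y\<in>orbit \<eta>. agree S x y \<and> \<not> agree T x y)} < N"
    (is "card ?B < N")
proof -
  let ?f = "\<lambda>w. restrict w S"
  have res: "?f (restrict x T) = restrict x S" for x :: "int \<times> int \<Rightarrow> 'a"
    using assms(2) by (simp add: restrict_restrict Int_absorb1)
  have im: "?f ` patterns \<eta> T = patterns \<eta> S"
    using res by (simp add: patterns_def image_image)
  have "card (?f ` patterns \<eta> T) + card ?B \<le> card (patterns \<eta> T)"
  proof (rule card_image_ge_of_fibres)
    show "finite (patterns \<eta> T)" by (rule finite_patterns) fact
    show "?B \<subseteq> ?f ` patterns \<eta> T" unfolding im by (auto simp: patterns_def)
    show "\<exists>u\<in>patterns \<eta> T. \<exists>v\<in>patterns \<eta> T. u \<noteq> v \<and> ?f u = b \<and> ?f v = b"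
      if b_amb: "b \<in> ?B" for b
    proof -
      obtain x y where b: "b = restrict x S" and o: "x \<in> orbit \<eta>" "y \<in> orbit \<eta>"
        and ag: "agree S x y" "\<not> agree T x y"
        using b_amb by blast
      have "restrict x T \<in> patterns \<eta> T" "restrict y T \<in> patterns \<eta> T"
        using o by (auto simp: patterns_def)
      moreover have "restrict x T \<noteq> restrict y T" using ag by (simp add: restrict_eq_iff_agree)
      moreover have "?f (restrict x T) = b" "?f (restrict y T) = b"
        using ag b by (simp_all only: res) (simp add: restrict_eq_iff_agree agree_sym)
      ultimately show ?thesis by blast
    qed
  qed
  then show ?thesis using assms(3) im by simp
qed

text \<open>Adding the \<open>N\<close> cells one after the other creates fewer than \<open>N\<close> new patterns altogether, so some
cell creates none, and that cell is a function of \<open>S\<close> and of the cells before it.\<close>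

lemma ex_determined_cell:
  fixes \<eta> :: "int \<times> int \<Rightarrow> 'a::finite" and cell :: "nat \<Rightarrow> int \<times> int"
  assumes "finite S" and less: "card (patterns \<eta> (S \<union> cell ` {..<N})) < card (patterns \<eta> S) + N"
  shows "\<exists>j<N. \<forall>x\<in>orbit \<eta>. \<forall>y\<in>orbit \<eta>.
    agree (S \<union> cell ` {..<j}) x y \<longrightarrow> x (cell j) = y (cell j)"
proof (rule ccontr)
  assume neg: "\<not> ?thesis"
  have "card (patterns \<eta> S) + j \<le> card (patterns \<eta> (S \<union> cell ` {..<j}))" if "j \<le> N" for j
    using that
  proof (induction j)
    case (Suc j)
    have "\<not> card (patterns \<eta> (S \<union> cell ` {..<Suc j})) \<le> card (patterns \<eta> (S \<union> cell ` {..<j}))"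
    proof
      assume le: "card (patterns \<eta> (S \<union> cell ` {..<Suc j})) \<le> card (patterns \<eta> (S \<union> cell ` {..<j}))"
      have "x (cell j) = y (cell j)"
        if "x \<in> orbit \<eta>" "y \<in> orbit \<eta>" "agree (S \<union> cell ` {..<j}) x y" for x y
        using determined_of_card_le[OF _ _ le that] assms(1)
        by (fastforce simp: agree_def)
      with neg Suc.prems show False by (meson Suc_le_lessD)
    qed
    with Suc show ?case by simp
  qed simp
  from this[of N] less show False by simp
qed

section \<open>Words with few windows are periodic\<close>

definition periodic_on :: "int \<Rightarrow> int \<Rightarrow> int \<Rightarrow> (int \<Rightarrow> 'b) \<Rightarrow> bool" where
  "periodic_on d a b f \<longleftrightarrow> (\<forall>i. a \<le> i \<and> i + d \<le> b \<longrightarrow> f (i + d) = f i)"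

lemma periodic_on_subset:
  "periodic_on d a b f \<Longrightarrow> a \<le> a' \<Longrightarrow> b' \<le> b \<Longrightarrow> periodic_on d a' b' f"
  by (auto simp: periodic_on_def)

lemma periodic_on_mult:
  assumes "periodic_on d a b f" "0 \<le> d"
  shows "periodic_on (int m * d) a b f"
proof (induction m)
  case (Suc m)
  show ?case unfolding periodic_on_def
  proof (intro allI impI)
    fix i assume i: "a \<le> i \<and> i + int (Suc m) * d \<le> b"
    have "0 \<le> int m * d" using assms(2) by simp
    moreover have expand: "int (Suc m) * d = int m * d + d" by (simp add: algebra_simps)
    ultimately have "f ((i + int m * d) + d) = f (i + int m * d)"
      using assms(1) i unfolding periodic_on_def by (smt (verit))
    also have "\<dots> = f i" using Suc i assms(2) expand unfolding periodic_on_def by (smt (verit))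
    finally show "f (i + int (Suc m) * d) = f i" unfolding expand by (simp add: add.assoc)
  qed
qed (simp add: periodic_on_def)

lemma periodic_on_dvd:
  assumes "periodic_on d a b f" "0 < d" "d dvd D" "0 \<le> D"
  shows "periodic_on D a b f"
proof -
  obtain c where c: "D = d * c" using assms(3) by (rule dvdE)
  then have "0 \<le> c" using assms by (simp add: zero_le_mult_iff)
  then show ?thesis using periodic_on_mult[OF assms(1), of "nat c"] assms(2) c
    by (simp add: mult.commute)
qed

text \<open>The number of windows of length \<open>l\<close> does not decrease with \<open>l\<close> and is still below \<open>N\<close> at \<open>l = N\<close>,
so it is stationary at some \<open>l < N\<close>; there a window determines the next letter. Among the first \<open>N\<close> positions two
have the same window, and from there on the word repeats with their difference as a period. That
difference is less than \<open>N\<close>, so \<open>fact N\<close> is a period that serves all words at once. Only the first \<open>N\<close>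
positions, where the repetition may not yet have started, are lost.\<close>

lemma finite_Morse_Hedlund:
  fixes f :: "int \<Rightarrow> 'b"
  assumes few: "card ((\<lambda>i. restrict (\<lambda>t. f (i + t)) {0..<int N}) ` {a..b}) < N"
  shows "periodic_on (fact N) (a + int N) b f"
proof (cases "a + int N \<le> b")
  case True
  define W where "W l = (\<lambda>i. restrict (\<lambda>t. f (i + t)) {0..<int l}) ` {a..b}" for l :: nat
  have finW: "finite (W l)" for l by (simp add: W_def)
  have restrict_W: "(\<lambda>w. restrict w {0..<int l}) ` W l' = W l" if "l \<le> l'" for l l'
    using that unfolding W_def image_image
    by (intro image_cong) (auto simp: restrict_def fun_eq_iff)
  have "\<exists>l<N. card (W (Suc l)) \<le> card (W l)"
  proof (rule ccontr)
    assume neg: "\<not> ?thesis"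
    have "l \<le> card (W l)" if "l \<le> N" for l
      using that
    proof (induction l)
      case (Suc l)
      then have "card (W l) < card (W (Suc l))" using neg by (simp add: not_le)
      with Suc show ?case by simp
    qed simp
    from this[of N] few show False by (simp add: W_def)
  qed
  then obtain l where l: "l < N" and le: "card (W (Suc l)) \<le> card (W l)" by blast
  have "card ((\<lambda>w. restrict w {0..<int l}) ` W (Suc l)) = card (W (Suc l))"
    using le restrict_W[of l "Suc l"] card_image_le[OF finW, of "\<lambda>w. restrict w {0..<int l}" "Suc l"]
    by simp
  then have inj: "inj_on (\<lambda>w. restrict w {0..<int l}) (W (Suc l))"
    by (rule eq_card_imp_inj_on[OF finW])
  have next_letter: "f (i + int l) = f (i' + int l)"
    if "i \<in> {a..b}" "i' \<in> {a..b}" and eq: "\<And>t. 0 \<le> t \<Longrightarrow> t < int l \<Longrightarrow> f (i + t) = f (i' + t)" for i i'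
  proof -
    let ?w = "\<lambda>i. restrict (\<lambda>t. f (i + t)) {0..<int (Suc l)}"
    have "restrict (?w i) {0..<int l} = restrict (?w i') {0..<int l}"
      using eq by (auto simp: restrict_def fun_eq_iff)
    moreover have "?w i \<in> W (Suc l)" "?w i' \<in> W (Suc l)" using that by (auto simp: W_def)
    ultimately have "?w i = ?w i'" using inj by (metis inj_onD)
    then have "?w i (int l) = ?w i' (int l)" by simp
    then show ?thesis by simp
  qed
  have "card (W l) < N"
    using few restrict_W[of l N] card_image_le[OF finW, of "\<lambda>w. restrict w {0..<int l}" N] l
    by (simp add: W_def)
  then have "\<not> inj_on (\<lambda>i. restrict (\<lambda>t. f (i + t)) {0..<int l}) {a..<a + int N}"
  proof -
    have "(\<lambda>i. restrict (\<lambda>t. f (i + t)) {0..<int l}) ` {a..<a + int N} \<subseteq> W l"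
      using True by (auto simp: W_def)
    then have "card ((\<lambda>i. restrict (\<lambda>t. f (i + t)) {0..<int l}) ` {a..<a + int N}) < N"
      using \<open>card (W l) < N\<close> card_mono[OF finW] le_less_trans by blast
    then show ?thesis by (auto dest: card_image)
  qed
  then obtain i1 i2 where i: "a \<le> i1" "i1 < i2" "i2 < a + int N"
    and eq: "restrict (\<lambda>t. f (i1 + t)) {0..<int l} = restrict (\<lambda>t. f (i2 + t)) {0..<int l}"
    unfolding inj_on_def by (metis (no_types, lifting) atLeastLessThan_iff linorder_less_linear)
  have start: "f (i1 + t) = f (i2 + t)" if "0 \<le> t" "t < int l" for t
    using fun_cong[OF eq, of t] that by simp
  have follow: "i2 + int s \<le> b \<longrightarrow> f (i1 + int s) = f (i2 + int s)" for s
  proof (induction s rule: less_induct)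
    case (less s)
    show ?case
    proof (cases "s < l")
      case False
      have "f ((i1 + int (s - l)) + int l) = f ((i2 + int (s - l)) + int l)" if "i2 + int s \<le> b"
      proof (rule next_letter)
        fix t assume t: "0 \<le> t" "t < int l"
        then have "f (i1 + int (s - l + nat t)) = f (i2 + int (s - l + nat t))"
          using less[of "s - l + nat t"] that False by auto
        then show "f (i1 + int (s - l) + t) = f (i2 + int (s - l) + t)"
          using t by (simp add: add.assoc)
      qed (use i that False in auto)
      then show ?thesis using False by (simp add: algebra_simps of_nat_diff)
    qed (use start in auto)
  qed
  have "periodic_on (i2 - i1) (a + int N) b f" unfolding periodic_on_def
  proof (intro allI impI)
    fix j assume j: "a + int N \<le> j \<and> j + (i2 - i1) \<le> b"
    then show "f (j + (i2 - i1)) = f j" using follow[of "nat (j - i1)"] i by (simp add: algebra_simps)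
  qed
  moreover have "(i2 - i1) dvd fact N"
  proof -
    have "nat (i2 - i1) dvd fact N" using i by (intro dvd_fact) auto
    then have "int (nat (i2 - i1)) dvd int (fact N)" by (simp only: int_dvd_int_iff)
    then show ?thesis using i by simp
  qed
  ultimately show ?thesis using periodic_on_dvd[of "i2 - i1" "a + int N" b f "fact N"] i by simp
next
  case False
  moreover have "(0::int) \<le> fact N" by simp
  ultimately show ?thesis unfolding periodic_on_def by (smt (verit))
qed

section \<open>Strips that determine the adjacent row\<close>

text \<open>A strip of height \<open>q\<close> occupies the rows \<open>0, \<dots>, q - 1\<close>, and \<open>e\<close> is the height of an adjacent row,
either \<open>q\<close> or \<open>- 1\<close>. A strip of period \<open>fact N\<close> can induce on the row \<open>e\<close> any period
\<open>d * fact N\<close> with \<open>d\<close> at most \<open>CARD('a) ^ N\<close>, the number of words of length \<open>N\<close>; the number \<open>Q\<close>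
is a common multiple of all these. The number \<open>M\<close> bounds the
loss at either end of an interval when periodicity passes from the strip to that row.\<close>

locale scarce_row =
  fixes \<eta> :: "int \<times> int \<Rightarrow> 'a::finite" and N q :: nat and e Q M :: int
  assumes scarce: "card (patterns \<eta> ({0..<int N} \<times> {0..<int q} \<union> (\<lambda>k. (int k, e)) ` {..<N}))
      < card (patterns \<eta> ({0..<int N} \<times> {0..<int q})) + N"
    and Q_def: "Q = fact N * fact (CARD('a) ^ N)"
    and M_def: "M = Q + 2 * int N"
begin

lemma Q_pos: "0 < Q"
  by (simp add: Q_def)

text \<open>The cell of the row that is determined by the cells to its left in an \<open>N\<close>-window and by the block
of the strip is used as a recurrence running to the right.\<close>

lemma row_determined_right:
  assumes "x \<in> orbit \<eta>" "y \<in> orbit \<eta>" and strip: "agree ({a..b} \<times> {0..<int q}) x y"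
    and window: "agree ({c..<c + int N} \<times> {e}) x y" and "a \<le> c"
  shows "agree ({c..b - int N} \<times> {e}) x y"
proof -
  obtain j where j: "j < N" and det: "\<And>x y. \<lbrakk>x \<in> orbit \<eta>; y \<in> orbit \<eta>;
      agree ({0..<int N} \<times> {0..<int q} \<union> (\<lambda>k. (int k, e)) ` {..<j}) x y\<rbrakk> \<Longrightarrow> x (int j, e) = y (int j, e)"
    using ex_determined_cell[OF _ scarce] by auto
  have "c + int n \<le> b - int N \<longrightarrow> x (c + int n, e) = y (c + int n, e)" for n
  proof (induction n rule: less_induct)
    case (less n)
    show ?case
    proof (cases "n < N")
      case True
      then show ?thesis using window by (auto simp: agree_def)
    next
      case False
      show ?thesis
      proof
        assume n: "c + int n \<le> b - int N"
        let ?v = "(c + int n - int j, 0) :: int \<times> int"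
        have "translate ?v x (int j, e) = translate ?v y (int j, e)"
        proof (rule det[OF translate_in_orbit[OF assms(1)] translate_in_orbit[OF assms(2)]])
          show "agree ({0..<int N} \<times> {0..<int q} \<union> (\<lambda>k. (int k, e)) ` {..<j}) (translate ?v x) (translate ?v y)"
            unfolding agree_Un
          proof
            show "agree ({0..<int N} \<times> {0..<int q}) (translate ?v x) (translate ?v y)"
              using strip j n False \<open>a \<le> c\<close> by (auto simp: agree_def)
            have "x (int k + (c + int n - int j), e) = y (int k + (c + int n - int j), e)" if "k < j" for k
            proof -
              have pos: "int k + (c + int n - int j) = c + int (n - (j - k))"
                using that j False by auto
              show ?thesis unfolding pos
                by (rule less[of "n - (j - k)", THEN mp]) (use that j n False in auto)
            qed
            then show "agree ((\<lambda>k. (int k, e)) ` {..<j}) (translate ?v x) (translate ?v y)"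
              by (auto simp: agree_def)
          qed
        qed
        then show "x (c + int n, e) = y (c + int n, e)" by (simp add: add.commute)
      qed
    qed
  qed
  note follow = this
  show ?thesis unfolding agree_def
  proof clarify
    fix i r assume "i \<in> {c..b - int N}"
    then show "x (i, e) = y (i, e)" using follow[of "nat (i - c)"] by auto
  qed
qed

text \<open>The same recurrence, running to the left; the cells of the row are added from right to left.\<close>

lemma row_determined_left:
  assumes "x \<in> orbit \<eta>" "y \<in> orbit \<eta>" and strip: "agree ({a..b} \<times> {0..<int q}) x y"
    and window: "agree ({c..<c + int N} \<times> {e}) x y" and "c + int N \<le> b + 1"
  shows "agree ({a + int N..<c + int N} \<times> {e}) x y"
proof -
  let ?cell = "\<lambda>k. (int N - 1 - int k, e)"
  have cells: "(\<lambda>k. (int k, e)) ` {..<N} = ?cell ` {..<N}"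
  proof -
    have "{..<N} = (\<lambda>k. N - 1 - k) ` {..<N}"
    proof (intro set_eqI iffI)
      fix k assume "k \<in> {..<N}"
      then show "k \<in> (\<lambda>k. N - 1 - k) ` {..<N}" by (intro image_eqI[of _ _ "N - 1 - k"]) auto
    qed auto
    then have "(\<lambda>k. (int k, e)) ` {..<N} = (\<lambda>k. (int k, e)) ` (\<lambda>k. N - 1 - k) ` {..<N}"
      by simp
    also have "\<dots> = ?cell ` {..<N}"
      unfolding image_image by (intro image_cong) (auto simp: of_nat_diff)
    finally show ?thesis .
  qed
  obtain j where j: "j < N" and det: "\<And>x y. \<lbrakk>x \<in> orbit \<eta>; y \<in> orbit \<eta>;
      agree ({0..<int N} \<times> {0..<int q} \<union> ?cell ` {..<j}) x y\<rbrakk> \<Longrightarrow> x (?cell j) = y (?cell j)"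
    using ex_determined_cell[OF _ scarce[unfolded cells]] by auto
  have "a + int N \<le> c + int N - 1 - int n \<longrightarrow> x (c + int N - 1 - int n, e) = y (c + int N - 1 - int n, e)" for n
  proof (induction n rule: less_induct)
    case (less n)
    show ?case
    proof (cases "n < N")
      case True
      then show ?thesis using window by (auto simp: agree_def)
    next
      case False
      show ?thesis
      proof
        assume n: "a + int N \<le> c + int N - 1 - int n"
        let ?v = "(c - int n + int j, 0) :: int \<times> int"
        have "translate ?v x (?cell j) = translate ?v y (?cell j)"
        proof (rule det[OF translate_in_orbit[OF assms(1)] translate_in_orbit[OF assms(2)]])
          show "agree ({0..<int N} \<times> {0..<int q} \<union> ?cell ` {..<j}) (translate ?v x) (translate ?v y)"
            unfolding agree_Un
          proof
            show "agree ({0..<int N} \<times> {0..<int q}) (translate ?v x) (translate ?v y)"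
              using strip j n False assms(5) by (auto simp: agree_def)
            have "x (int N - 1 - int k + (c - int n + int j), e) = y (int N - 1 - int k + (c - int n + int j), e)"
              if "k < j" for k
            proof -
              have pos: "int N - 1 - int k + (c - int n + int j) = c + int N - 1 - int (n - (j - k))"
                using that j False by auto
              show ?thesis unfolding pos
                by (rule less[of "n - (j - k)", THEN mp]) (use that j n False in auto)
            qed
            then show "agree (?cell ` {..<j}) (translate ?v x) (translate ?v y)"
              by (auto simp: agree_def)
          qed
        qed
        then show "x (c + int N - 1 - int n, e) = y (c + int N - 1 - int n, e)"
          by (simp add: algebra_simps)
      qed
    qed
  qed
  note follow = this
  show ?thesis unfolding agree_def
  proof clarify
    fix i r assume "i \<in> {a + int N..<c + int N}"
    then show "x (i, e) = y (i, e)" using follow[of "nat (c + int N - 1 - i)"] by auto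
  qed
qed

lemma row_determined_of_window:
  assumes "x \<in> orbit \<eta>" "y \<in> orbit \<eta>" "agree ({a..b} \<times> {0..<int q}) x y"
    and "agree ({c..<c + int N} \<times> {e}) x y" "a \<le> c" "c + int N \<le> b + 1"
  shows "agree ({a + int N..b - int N} \<times> {e}) x y"
proof -
  have "agree ({a + int N..<c + int N} \<times> {e} \<union> {c..b - int N} \<times> {e}) x y"
    using row_determined_left[OF assms(1-4,6)] row_determined_right[OF assms(1-5)]
    by (simp add: agree_Un)
  then show ?thesis by (rule agree_subset) auto
qed

text \<open>If the row is not determined, then it is ambiguous everywhere: agreement on a single \<open>N\<close>-window
of the row would spread along the row up to the margins. Thus every \<open>N \<times> q\<close> block of the strip is one of the
fewer than \<open>N\<close> patterns with several extensions, and \<open>finite_Morse_Hedlund\<close> applies to the strip, read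
as a word whose letters are its columns.\<close>

lemma periodic_or_row_determined:
  assumes x: "x \<in> orbit \<eta>" and y: "y \<in> orbit \<eta>" and strip: "agree ({a..b} \<times> {0..<int q}) x y"
  shows "(\<forall>j\<in>{0..<int q}. periodic_on (fact N) (a + int N) (b - int N) (\<lambda>i. x (i, j))) \<or>
    agree ({a + int N..b - int N} \<times> {e}) x y"
proof (rule disjCI)
  assume differ: "\<not> agree ({a + int N..b - int N} \<times> {e}) x y"
  let ?S = "{0..<int N} \<times> {0..<int q}" and ?E = "(\<lambda>k. (int k, e)) ` {..<N}"
  let ?B = "{restrict x ?S | x. x \<in> orbit \<eta> \<and> (\<exists>y\<in>orbit \<eta>. agree ?S x y \<and> \<not> agree (?S \<union> ?E) x y)}"
  have few: "card ?B < N" by (rule card_ambiguous_less[OF _ _ scarce]) auto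
  have finB: "finite ?B"
    by (rule finite_subset[OF _ finite_patterns[of ?S \<eta>]]) (auto simp: patterns_def)
  have windows: "restrict (translate (i, 0) x) ?S \<in> ?B" if i: "i \<in> {a..b + 1 - int N}" for i
  proof -
    have "\<not> agree ({i..<i + int N} \<times> {e}) x y"
      using row_determined_of_window[OF x y strip, of i] differ i by auto
    then obtain c where c: "c \<in> {i..<i + int N}" "x (c, e) \<noteq> y (c, e)"
      by (auto simp: agree_def)
    have "\<not> agree (?S \<union> ?E) (translate (i, 0) x) (translate (i, 0) y)"
    proof
      assume "agree (?S \<union> ?E) (translate (i, 0) x) (translate (i, 0) y)"
      moreover have "(c - i, e) \<in> ?E" using c by (intro image_eqI[of _ _ "nat (c - i)"]) auto
      ultimately have "translate (i, 0) x (c - i, e) = translate (i, 0) y (c - i, e)"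
        unfolding agree_def by blast
      with c show False by simp
    qed
    moreover have "agree ?S (translate (i, 0) x) (translate (i, 0) y)"
      using strip i by (auto simp: agree_def)
    ultimately show ?thesis using translate_in_orbit[OF x] translate_in_orbit[OF y] by blast
  qed
  define f where "f i = restrict (\<lambda>j. x (i, j)) {0..<int q}" for i
  define g where "g w = restrict (\<lambda>t. restrict (\<lambda>j. w (t, j)) {0..<int q}) {0..<int N}"
    for w :: "int \<times> int \<Rightarrow> 'a"
  have "(\<lambda>i. restrict (\<lambda>t. f (i + t)) {0..<int N}) ` {a..b + 1 - int N} \<subseteq> g ` ?B"
  proof clarify
    fix i assume "i \<in> {a..b + 1 - int N}"
    moreover have "restrict (\<lambda>t. f (i + t)) {0..<int N} = g (restrict (translate (i, 0) x) ?S)"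
      by (auto simp: f_def g_def restrict_def fun_eq_iff add.commute)
    ultimately show "restrict (\<lambda>t. f (i + t)) {0..<int N} \<in> g ` ?B" using windows by blast
  qed
  then have "card ((\<lambda>i. restrict (\<lambda>t. f (i + t)) {0..<int N}) ` {a..b + 1 - int N}) \<le> card ?B"
    by (rule order_trans[OF card_mono[OF finite_imageI[OF finB]] card_image_le[OF finB]])
  then have "periodic_on (fact N) (a + int N) (b + 1 - int N) f"
    using few by (intro finite_Morse_Hedlund) simp
  then have per: "f (i + fact N) = f i" if "a + int N \<le> i" "i + fact N \<le> b - int N" for i
    using that by (simp add: periodic_on_def)
  have "x (i + fact N, j) = x (i, j)"
    if "a + int N \<le> i" "i + fact N \<le> b - int N" "0 \<le> j" "j < int q" for i j
    using fun_cong[OF per[OF that(1,2)], of j] that by (simp add: f_def)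
  then show "\<forall>j\<in>{0..<int q}. periodic_on (fact N) (a + int N) (b - int N) (\<lambda>i. x (i, j))"
    by (auto simp: periodic_on_def)
qed

lemma N_le_M: "int N \<le> M"
  using Q_pos by (simp add: M_def)

text \<open>Compare \<open>x\<close> with its translate by \<open>Q\<close>, which agrees with \<open>x\<close> on the strip. Either the row is
determined, and then it inherits the period \<open>Q\<close>; or the strip has the period \<open>fact N\<close>. In
that case two \<open>N\<close>-windows of the row at distance \<open>d * fact N\<close> coincide by the pigeonhole principle,
and since the strip is invariant under this shift, the recurrence makes the whole row invariant. This
shift divides \<open>Q\<close>; so the period of a strip does not grow from row to row.\<close>

lemma row_periodic:
  assumes x: "x \<in> orbit \<eta>"
    and per: "\<And>j. j \<in> {0..<int q} \<Longrightarrow> periodic_on Q a b (\<lambda>i. x (i, j))"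
  shows "periodic_on Q (a + M) (b - M) (\<lambda>i. x (i, e))"
proof -
  have strip: "agree ({a..b - Q} \<times> {0..<int q}) x (translate (Q, 0) x)"
    using per by (auto simp: agree_def periodic_on_def)
  from periodic_or_row_determined[OF x translate_in_orbit[OF x] strip]
  show ?thesis
  proof
    assume "agree ({a + int N..b - Q - int N} \<times> {e}) x (translate (Q, 0) x)"
    then show ?thesis using Q_pos by (auto simp: agree_def periodic_on_def M_def)
  next
    let ?p = "fact N :: int" and ?A = "CARD('a) ^ N"
    assume "\<forall>j\<in>{0..<int q}. periodic_on (fact N) (a + int N) (b - Q - int N) (\<lambda>i. x (i, j))"
    then have per_p: "periodic_on (int d * ?p) (a + int N) (b - Q - int N) (\<lambda>i. x (i, j))"
      if "j \<in> {0..<int q}" for d j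
      using that by (intro periodic_on_mult) auto
    show ?thesis unfolding periodic_on_def
    proof (intro allI impI)
      fix i assume i: "a + M \<le> i \<and> i + Q \<le> b - M"
      define win where "win s = restrict (\<lambda>t. x (i + int s * ?p + t, e)) {0..<int N}" for s :: nat
      have "\<not> inj_on win {..?A}"
      proof
        assume "inj_on win {..?A}"
        moreover have "win ` {..?A} \<subseteq> {0..<int N} \<rightarrow>\<^sub>E UNIV" by (auto simp: win_def)
        ultimately have "card {..?A} \<le> card ({0..<int N} \<rightarrow>\<^sub>E (UNIV :: 'a set))"
          by (intro card_inj_on_le) (simp_all add: finite_PiE)
        then show False by (simp add: card_PiE)
      qed
      then obtain s s' where s: "s < s'" "s' \<le> ?A" and eq: "win s = win s'"
        unfolding inj_on_def by (metis atMost_iff linorder_less_linear)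
      define d where "d = s' - s"
      have d: "0 < d" "d \<le> ?A" "s + d = s'" using s by (auto simp: d_def)
      have bound: "int k * ?p \<le> Q" if "k \<le> ?A" for k
      proof -
        have "int k \<le> fact ?A" using that fact_ge_self[of ?A] by (metis le_trans of_nat_fact of_nat_le_iff)
        then show ?thesis unfolding Q_def using mult_left_mono[of "int k" "fact ?A" ?p]
          by (simp add: mult.commute)
      qed
      have s'_split: "int s' * ?p = int s * ?p + int d * ?p"
        using d by (metis distrib_right of_nat_add)
      have nonneg: "0 \<le> int s * ?p" "0 \<le> int d * ?p" by simp_all
      have "agree ({a + int N + int N..b - Q - int N - int d * ?p - int N} \<times> {e}) x (translate (int d * ?p, 0) x)"
      proof (rule row_determined_of_window[OF x translate_in_orbit[OF x]])
        show "agree ({a + int N..b - Q - int N - int d * ?p} \<times> {0..<int q}) x (translate (int d * ?p, 0) x)"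
          using per_p[of _ d] by (auto simp: agree_def periodic_on_def)
        show "agree ({i + int s * ?p..<i + int s * ?p + int N} \<times> {e}) x (translate (int d * ?p, 0) x)"
          unfolding agree_def
        proof clarify
          fix k assume k: "k \<in> {i + int s * ?p..<i + int s * ?p + int N}"
          show "x (k, e) = translate (int d * ?p, 0) x (k, e)"
            using fun_cong[OF eq, of "k - (i + int s * ?p)"] k s'_split
            by (simp add: win_def algebra_simps)
        qed
        show "a + int N \<le> i + int s * ?p" using i[unfolded M_def] nonneg Q_pos by linarith
        show "i + int s * ?p + int N \<le> b - Q - int N - int d * ?p + 1"
          using i[unfolded M_def] bound[of s'] s s'_split by linarith
      qed
      then have "periodic_on (int d * ?p) (a + 2 * int N) (b - Q - 2 * int N) (\<lambda>i. x (i, e))"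
        by (auto simp: agree_def periodic_on_def)
      moreover have "int d * ?p dvd Q"
      proof -
        have "d dvd fact ?A" using d by (intro dvd_fact) auto
        then have "int d dvd fact ?A" by (metis int_dvd_int_iff of_nat_fact)
        then show ?thesis unfolding Q_def by (metis mult.commute mult_dvd_mono dvd_refl)
      qed
      ultimately have "periodic_on Q (a + 2 * int N) (b - Q - 2 * int N) (\<lambda>i. x (i, e))"
        using periodic_on_dvd[of "int d * ?p" _ _ "\<lambda>i. x (i, e)" Q] d Q_pos by simp
      then show "x (i + Q, e) = x (i, e)" using i Q_pos by (auto simp: periodic_on_def M_def)
    qed
  qed
qed

end

section \<open>Breaks of periodicity spread through the plane\<close>

locale scarce_strip =
  fixes \<eta> :: "int \<times> int \<Rightarrow> 'a::finite" and N q :: nat and Q M :: int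
  assumes scarce: "card (patterns \<eta> ({0..<int N} \<times> {0..<int q + 1}))
      < card (patterns \<eta> ({0..<int N} \<times> {0..<int q})) + N"
    and Q_def: "Q = fact N * fact (CARD('a) ^ N)"
    and M_def: "M = Q + 2 * int N"

sublocale scarce_strip \<subseteq> above: scarce_row \<eta> N q "int q" Q M
proof
  have "{0..<int N} \<times> {0..<int q} \<union> (\<lambda>k. (int k, int q)) ` {..<N} = {0..<int N} \<times> {0..<int q + 1}"
  proof (intro set_eqI iffI)
    fix z assume "z \<in> {0..<int N} \<times> {0..<int q + 1}"
    then obtain i j where z: "z = (i, j)" "0 \<le> i" "i < int N" "0 \<le> j" "j \<le> int q" by auto
    then show "z \<in> {0..<int N} \<times> {0..<int q} \<union> (\<lambda>k. (int k, int q)) ` {..<N}"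
      by (cases "j = int q") (auto intro!: image_eqI[of _ _ "nat i"])
  qed auto
  then show "card (patterns \<eta> ({0..<int N} \<times> {0..<int q} \<union> (\<lambda>k. (int k, int q)) ` {..<N}))
      < card (patterns \<eta> ({0..<int N} \<times> {0..<int q})) + N"
    using scarce by simp
qed (rule Q_def M_def)+

sublocale scarce_strip \<subseteq> below: scarce_row \<eta> N q "-1" Q M
proof
  let ?R = "{0..<int N} \<times> {0..<int q + 1}"
  have "{0..<int N} \<times> {0..<int q} \<union> (\<lambda>k. (int k, - 1)) ` {..<N} = (\<lambda>z. z + (0, - 1)) ` ?R" (is "?L = _")
  proof (intro set_eqI iffI)
    fix z assume "z \<in> ?L"
    then show "z \<in> (\<lambda>z. z + (0, - 1)) ` ?R" by (intro image_eqI[of _ _ "z + (0, 1)"]) (auto simp: zero_prod_def)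
  next
    fix z assume "z \<in> (\<lambda>z. z + (0, - 1)) ` ?R"
    then obtain i j where z: "z = (i, j - 1)" "0 \<le> i" "i < int N" "0 \<le> j" "j \<le> int q" by auto
    then show "z \<in> ?L" by (cases "j = 0") (auto intro!: image_eqI[of _ _ "nat i"])
  qed
  then show "card (patterns \<eta> ?L) < card (patterns \<eta> ({0..<int N} \<times> {0..<int q})) + N"
    using scarce card_patterns_translate_le[of ?R \<eta> "(0, - 1)"] by simp
qed (rule Q_def M_def)+

context scarce_strip
begin

definition broken :: "(int \<times> int \<Rightarrow> 'a) \<Rightarrow> int \<Rightarrow> int \<Rightarrow> int \<Rightarrow> bool" where
  "broken x c d h \<longleftrightarrow> (\<exists>j\<in>{h..<h + int q}. \<not> periodic_on Q c d (\<lambda>i. x (i, j)))"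

lemma fact_dvd_Q: "(fact N :: int) dvd Q"
  by (simp add: Q_def)

text \<open>A break in the middle of the strip excludes the periodic alternative, so both adjacent rows are
determined.\<close>

lemma agree_next_strip:
  assumes x: "x \<in> orbit \<eta>" and y: "y \<in> orbit \<eta>" and strip: "agree ({a..b} \<times> {h..<h + int q}) x y"
    and br: "broken x c d h" and "a + int N \<le> c" "d \<le> b - int N" and "s = 1 \<or> s = - 1"
  shows "agree ({a + int N..b - int N} \<times> {h + s..<h + s + int q}) x y"
proof -
  let ?x = "translate (0, h) x" and ?y = "translate (0, h) y"
  have o: "?x \<in> orbit \<eta>" "?y \<in> orbit \<eta>" using x y by (simp_all only: translate_in_orbit)
  have strip0: "agree ({a..b} \<times> {0..<int q}) ?x ?y"
    using strip by (auto simp: agree_def)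
  have "\<not> (\<forall>j\<in>{0..<int q}. periodic_on (fact N) (a + int N) (b - int N) (\<lambda>i. ?x (i, j)))"
  proof
    assume per: "\<forall>j\<in>{0..<int q}. periodic_on (fact N) (a + int N) (b - int N) (\<lambda>i. ?x (i, j))"
    have "periodic_on Q c d (\<lambda>i. x (i, j))" if "j \<in> {h..<h + int q}" for j
    proof -
      have "periodic_on (fact N) (a + int N) (b - int N) (\<lambda>i. x (i, j))"
        using per[rule_format, of "j - h"] that by simp
      then have "periodic_on (fact N) c d (\<lambda>i. x (i, j))"
        by (rule periodic_on_subset) fact+
      then show ?thesis
        using periodic_on_dvd[OF _ _ fact_dvd_Q] above.Q_pos by simp
    qed
    with br show False by (auto simp: broken_def)
  qed
  then have "agree ({a + int N..b - int N} \<times> {int q}) ?x ?y"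
    and "agree ({a + int N..b - int N} \<times> {- 1}) ?x ?y"
    using above.periodic_or_row_determined[OF o strip0] below.periodic_or_row_determined[OF o strip0]
    by blast+
  then have new: "x (i, int q + h) = y (i, int q + h) \<and> x (i, h - 1) = y (i, h - 1)"
    if "i \<in> {a + int N..b - int N}" for i
    using that by (auto simp: agree_def)
  show ?thesis unfolding agree_def
  proof clarify
    fix i j assume ij: "i \<in> {a + int N..b - int N}" "j \<in> {h + s..<h + s + int q}"
    show "x (i, j) = y (i, j)"
    proof (cases "j \<in> {h..<h + int q}")
      case True
      then show ?thesis using strip ij by (auto simp: agree_def)
    next
      case False
      then have "j = int q + h \<or> j = h - 1" using ij assms(7) by auto
      then show ?thesis using new[OF ij(1)] by auto
    qed
  qed
qed

lemma row_periodic_at_height: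
  assumes x: "x \<in> orbit \<eta>" and unbroken: "\<not> broken x a b h" and "r = h + int q \<or> r = h - 1"
  shows "periodic_on Q (a + M) (b - M) (\<lambda>i. x (i, r))"
proof -
  let ?x = "translate (0, h) x"
  have "periodic_on Q a b (\<lambda>i. ?x (i, j))" if "j \<in> {0..<int q}" for j
    using unbroken that by (auto simp: broken_def)
  note above.row_periodic[OF translate_in_orbit[OF x] this]
    and below.row_periodic[OF translate_in_orbit[OF x] this]
  then show ?thesis using assms(3) by (auto simp: add.commute)
qed

text \<open>A break cannot disappear: if the next strip had no break near by, its periodicity would pass back
to the row that the two strips do not share.\<close>

lemma broken_next_strip:
  assumes x: "x \<in> orbit \<eta>" and br: "broken x c d h" and s: "s = 1 \<or> s = - 1"
  shows "broken x (c - M) (d + M) (h + s)"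
proof (rule ccontr)
  assume unbroken: "\<not> broken x (c - M) (d + M) (h + s)"
  let ?r = "if s = 1 then h else h + int q - 1"
  have new: "periodic_on Q c d (\<lambda>i. x (i, ?r))"
    using row_periodic_at_height[OF x unbroken, of ?r] s by auto
  have "periodic_on Q c d (\<lambda>i. x (i, j))" if j: "j \<in> {h..<h + int q}" for j
  proof (cases "j = ?r")
    case False
    then have "j \<in> {h + s..<h + s + int q}" using j s by auto
    then have "periodic_on Q (c - M) (d + M) (\<lambda>i. x (i, j))"
      using unbroken by (auto simp: broken_def)
    then show ?thesis using above.N_le_M by (rule_tac periodic_on_subset) auto
  qed (use new in simp)
  with br show False by (auto simp: broken_def)
qed

lemma agree_spread:
  assumes "x \<in> orbit \<eta>" "y \<in> orbit \<eta>" "agree ({a..b} \<times> {h..<h + int q}) x y" "broken x c d h"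
    and "a + 2 * int n * M \<le> c" "d \<le> b - 2 * int n * M" and "s = 1 \<or> s = - 1"
  shows "agree ({a + int n * M..b - int n * M} \<times> {h + s * int n..<h + s * int n + int q}) x y \<and>
    broken x (c - int n * M) (d + int n * M) (h + s * int n)"
  using assms(5,6)
proof (induction n)
  case 0
  then show ?case using assms(3,4) by simp
next
  case (Suc n)
  have M: "int N \<le> M" "0 \<le> M" "0 \<le> int n * M" using above.N_le_M by auto
  have Suc_M: "int (Suc n) * M = int n * M + M" "2 * int (Suc n) * M = 2 * int n * M + 2 * M"
    "s * int (Suc n) = s * int n + s"
    by (simp_all add: algebra_simps)
  have dbl: "2 * int n * M = int n * M + int n * M" by simp
  have IH: "agree ({a + int n * M..b - int n * M} \<times> {h + s * int n..<h + s * int n + int q}) x y"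
    "broken x (c - int n * M) (d + int n * M) (h + s * int n)"
    using Suc.IH Suc.prems M unfolding Suc_M by linarith+
  have "agree ({a + int n * M + int N..b - int n * M - int N}
      \<times> {h + s * int n + s..<h + s * int n + s + int q}) x y"
    by (rule agree_next_strip[OF assms(1,2) IH _ _ assms(7)])
      (use Suc.prems M in \<open>unfold Suc_M, unfold dbl, linarith\<close>)+
  then have "agree ({a + int (Suc n) * M..b - int (Suc n) * M}
      \<times> {h + s * int (Suc n)..<h + s * int (Suc n) + int q}) x y"
    by (rule agree_subset) (use M in \<open>unfold Suc_M, auto\<close>)
  moreover have "broken x (c - int (Suc n) * M) (d + int (Suc n) * M) (h + s * int (Suc n))"
    using broken_next_strip[OF assms(1) IH(2) assms(7)] unfolding Suc_M by (simp add: algebra_simps)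
  ultimately show ?case by blast
qed

text \<open>The interval of agreement shrinks and the interval containing the break grows by \<open>M\<close> at each end
per row; a break that starts at distance \<open>2 m M\<close> from both ends of the strip therefore survives for
\<open>m\<close> rows.\<close>

lemma agree_on_cone:
  assumes xy: "x \<in> orbit \<eta>" "y \<in> orbit \<eta>" and strip: "agree ({a..b} \<times> {h..<h + int q}) x y"
    and br: "broken x c d h" and ac: "a + 2 * int m * M \<le> c" and db: "d \<le> b - 2 * int m * M"
  shows "agree ({a + int m * M..b - int m * M} \<times> {h - int m..<h + int q + int m}) x y"
  unfolding agree_def
proof clarify
  fix i r assume i: "i \<in> {a + int m * M..b - int m * M}" and r: "r \<in> {h - int m..<h + int q + int m}"
  have q: "0 < q" using br by (auto simp: broken_def)
  have M: "0 \<le> M" using above.N_le_M by simp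
  have at: "x (i, r) = y (i, r)"
    if s: "s = 1 \<or> s = - 1" and n: "n \<le> m" and r: "r \<in> {h + s * int n..<h + s * int n + int q}" for s n
  proof -
    have le: "int n * M \<le> int m * M" using n M by (simp add: mult_right_mono)
    have "agree ({a + int n * M..b - int n * M} \<times> {h + s * int n..<h + s * int n + int q}) x y"
      using agree_spread[OF xy strip br _ _ s, of n] ac db le by auto
    then show ?thesis using i r le by (auto simp: agree_def)
  qed
  consider "r < h" | "h \<le> r" "r < h + int q" | "h + int q \<le> r" by linarith
  then show "x (i, r) = y (i, r)"
  proof cases
    case 1
    then show ?thesis using at[of "- 1" "nat (h - r)"] r q by auto
  next
    case 2
    then show ?thesis using at[of 1 0] by auto
  next
    case 3
    then show ?thesis using at[of 1 "nat (r - (h + int q) + 1)"] r q by auto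
  qed
qed

lemma periodic_of_unbroken_strip:
  assumes x: "x \<in> orbit \<eta>" and unbroken: "\<And>a b. \<not> broken x a b h"
  shows "x (i + Q, j) = x (i, j)"
proof -
  have row: "x (i + Q, r) = x (i, r)"
    if "\<And>a b. \<not> broken x a b h" "r = h + int q \<or> r = h - 1" for h r i
    using row_periodic_at_height[OF x that(1)[of "i - M" "i + Q + M"] that(2)]
    by (simp add: periodic_on_def)
  have next_unbroken: "\<not> broken x a b (h + s)"
    if h: "\<And>a b. \<not> broken x a b h" and s: "s = 1 \<or> s = - 1" for h s a b
  proof -
    have "broken x (a - M) (b + M) ((h + s) + (- s))" if "broken x a b (h + s)"
      using broken_next_strip[OF x that, of "- s"] s by auto
    then show ?thesis using h by auto
  qed
  have "\<forall>a b. \<not> broken x a b k" for k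
  proof (induction k rule: int_induct[of _ h])
    case base
    show ?case using unbroken by blast
  next
    case (step1 k)
    then show ?case using next_unbroken[of k 1] by blast
  next
    case (step2 k)
    then show ?case using next_unbroken[of k "- 1"] by simp
  qed
  then show ?thesis using row[of "j - int q" j] by simp
qed

text \<open>Take the break closest to the square. If it is far away, then \<open>x\<close> is \<open>Q\<close>-periodic all the way
from the square to the break, and a translation by a multiple of \<open>Q\<close> moves the break close to the square
without changing the pattern on the square.\<close>

lemma ex_nearby_break:
  assumes aper: "\<eta> (i0 + Q, j0) \<noteq> \<eta> (i0, j0)" and x: "x \<in> orbit \<eta>" and m: "q \<le> m"
  shows "\<exists>x'\<in>orbit \<eta>. agree ({0..<int m} \<times> {0..<int m}) x x' \<and>
    (\<exists>c\<in>{- (int m + Q)..int m + Q}. \<exists>h\<in>{0..int m - int q}. broken x' c (c + Q) h)"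
proof -
  define C where "C = {c. \<exists>j\<in>{0..<int m}. x (c + Q, j) \<noteq> x (c, j)}"
  obtain v where v: "x = translate v \<eta>" using x by (auto simp: orbit_def)
  have "x ((i0 - fst v) + Q, j0 - snd v) \<noteq> x (i0 - fst v, j0 - snd v)"
    using aper v by (cases v) (simp add: algebra_simps)
  then obtain a b where "broken x a b 0" using periodic_of_unbroken_strip[OF x] by blast
  then obtain c0 j' where j': "0 \<le> j'" "j' < int q" "x (c0 + Q, j') \<noteq> x (c0, j')"
    by (auto simp: broken_def periodic_on_def)
  then have "c0 \<in> C" using m by (auto simp: C_def)
  then obtain c where c: "c \<in> C" and least: "\<And>c'. c' \<in> C \<Longrightarrow> nat \<bar>c\<bar> \<le> nat \<bar>c'\<bar>"
    using ex_has_least_nat[of "\<lambda>c. c \<in> C" c0 "\<lambda>c. nat \<bar>c\<bar>"] by blast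
  obtain j where j: "0 \<le> j" "j < int m" "x (c + Q, j) \<noteq> x (c, j)"
    using c by (auto simp: C_def)
  have Q: "0 < Q" by (rule above.Q_pos)
  have inner: "periodic_on Q (1 - \<bar>c\<bar>) (\<bar>c\<bar> - 1 + Q) (\<lambda>i. x (i, r))" if "0 \<le> r" "r < int m" for r
    unfolding periodic_on_def
  proof (intro allI impI)
    fix i assume i: "1 - \<bar>c\<bar> \<le> i \<and> i + Q \<le> \<bar>c\<bar> - 1 + Q"
    then have "i \<notin> C" using least[of i] by auto
    then show "x (i + Q, r) = x (i, r)" using that by (auto simp: C_def)
  qed
  have shifted: "translate (k * Q, 0) x \<in> orbit \<eta> \<and>
      x (c - k * Q + k * Q + Q, j) \<noteq> x (c - k * Q + k * Q, j)" for k
    using j translate_in_orbit[OF x] by auto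
  have "\<exists>k. c - k * Q \<in> {- (int m + Q)..int m + Q} \<and>
      agree ({0..<int m} \<times> {0..<int m}) x (translate (k * Q, 0) x)"
  proof -
    consider "\<bar>c\<bar> \<le> int m + Q" | "int m + Q < c" | "c < - (int m + Q)" by linarith
    then show ?thesis
    proof cases
      case 1
      then show ?thesis by (intro exI[of _ 0]) (auto simp: agree_def)
    next
      case 2
      \<comment> \<open>This shift puts the break into one of the columns \<open>m, \<dots>, m + Q - 1\<close>, to the right of the square.\<close>
      define k where "k = (c - int m) div Q"
      have k: "0 \<le> k" "c - int m = k * Q + (c - int m) mod Q"
        "0 \<le> (c - int m) mod Q" "(c - int m) mod Q < Q"
        using 2 Q by (simp_all add: k_def pos_imp_zdiv_nonneg_iff)
      have "x (i + k * Q, r) = x (i, r)" if "0 \<le> i" "i < int m" "0 \<le> r" "r < int m" for i r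
      proof -
        have "periodic_on (k * Q) (1 - \<bar>c\<bar>) (\<bar>c\<bar> - 1 + Q) (\<lambda>i. x (i, r))"
          using periodic_on_mult[OF inner[OF that(3,4)], of "nat k"] k Q by simp
        moreover have "1 - \<bar>c\<bar> \<le> i" "i + k * Q \<le> \<bar>c\<bar> - 1 + Q" using that k Q 2 by linarith+
        ultimately show ?thesis unfolding periodic_on_def by blast
      qed
      then have "agree ({0..<int m} \<times> {0..<int m}) x (translate (k * Q, 0) x)"
        by (auto simp: agree_def)
      moreover have "c - k * Q \<in> {- (int m + Q)..int m + Q}"
        unfolding atLeastAtMost_iff using 2 k Q by linarith
      ultimately show ?thesis by blast
    next
      case 3
      \<comment> \<open>This shift puts the break into one of the columns \<open>- Q, \<dots>, - 1\<close>, to the left of the square.\<close>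
      define k where "k = (- c - 1) div Q"
      have k: "0 \<le> k" "- c - 1 = k * Q + (- c - 1) mod Q"
        "0 \<le> (- c - 1) mod Q" "(- c - 1) mod Q < Q"
        using 3 Q by (simp_all add: k_def pos_imp_zdiv_nonneg_iff)
      have "x (i - k * Q + k * Q, r) = x (i - k * Q, r)"
        if "0 \<le> i" "i < int m" "0 \<le> r" "r < int m" for i r
      proof -
        have "periodic_on (k * Q) (1 - \<bar>c\<bar>) (\<bar>c\<bar> - 1 + Q) (\<lambda>i. x (i, r))"
          using periodic_on_mult[OF inner[OF that(3,4)], of "nat k"] k Q by simp
        moreover have "1 - \<bar>c\<bar> \<le> i - k * Q" "i - k * Q + k * Q \<le> \<bar>c\<bar> - 1 + Q"
          using that k Q 3 by linarith+
        ultimately show ?thesis unfolding periodic_on_def by blast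
      qed
      then have "agree ({0..<int m} \<times> {0..<int m}) x (translate (- k * Q, 0) x)"
        by (auto simp: agree_def)
      moreover have "c - - k * Q \<in> {- (int m + Q)..int m + Q}"
        unfolding atLeastAtMost_iff minus_mult_left[symmetric] using 3 k Q by linarith
      ultimately show ?thesis by blast
    qed
  qed
  then obtain k where k: "c - k * Q \<in> {- (int m + Q)..int m + Q}"
    "agree ({0..<int m} \<times> {0..<int m}) x (translate (k * Q, 0) x)" by blast
  \<comment> \<open>The lowest strip in the square that contains the row \<open>j\<close>.\<close>
  define h where "h = max 0 (j - int q + 1)"
  have "0 < q" using j' by linarith
  then have h: "h \<in> {0..int m - int q}" "j \<in> {h..<h + int q}"
    using j m by (auto simp: h_def)
  have "broken (translate (k * Q, 0) x) (c - k * Q) (c - k * Q + Q) h"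
    unfolding broken_def
    by (rule bexI[OF _ h(2)]) (use shifted[of k] in \<open>auto simp: periodic_on_def\<close>)
  then show ?thesis using k h(1) shifted[of k] by blast
qed

text \<open>The labels are the column \<open>c\<close> and the height \<open>h\<close> of a nearby break and the pattern on a strip of
width \<open>n\<close> around it. The strip reaches \<open>4 m M\<close> to the left and at least as far to the right of \<open>c\<close>.
Of this, \<open>2 m M\<close> keeps the break inside while the cone grows over \<open>m\<close> rows. The cone itself loses
\<open>m M\<close>, and what is left covers the square, which lies within \<open>2 m + Q\<close> columns of the break.\<close>

lemma square_patterns_le:
  assumes aper: "\<eta> (i0 + Q, j0) \<noteq> \<eta> (i0, j0)" and m: "q \<le> m" "0 < m"
    and n: "8 * int m * M < int n"
  shows "card (patterns \<eta> ({0..<int m} \<times> {0..<int m}))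
    \<le> nat (2 * (int m + Q) + 1) * (m + 1) * card (patterns \<eta> ({0..<int n} \<times> {0..<int q}))"
proof -
  let ?sq = "{0..<int m} \<times> {0..<int m}" and ?st = "{0..<int n} \<times> {0..<int q}"
  let ?C = "{- (int m + Q)..int m + Q}" and ?H = "{0..int m - int q}"
  let ?lab = "\<lambda>x (c, h, w). \<exists>x'\<in>orbit \<eta>. agree ?sq x x' \<and> broken x' c (c + Q) h \<and>
      restrict (translate (c - 4 * int m * M, h) x') ?st = w"
  have "0 \<le> (int m - 1) * (M - 1)"
    using m above.Q_pos by (intro mult_nonneg_nonneg) (auto simp: M_def)
  then have mM: "int m + M \<le> int m * M + 1" by (simp add: algebra_simps)
  have M: "0 < Q" "Q + 2 \<le> M"
  proof -
    show "0 < Q" by (rule above.Q_pos)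
    have "0 < N" using scarce card_patterns_mono[of "{0..<int N} \<times> {0..<int q}" "{0..<int N} \<times> {0..<int q + 1}" \<eta>]
      by (cases N) auto
    then show "Q + 2 \<le> M" by (simp add: M_def)
  qed
  have assoc: "2 * int m * M = 2 * (int m * M)" "4 * int m * M = 4 * (int m * M)"
    "8 * int m * M = 8 * (int m * M)" by simp_all
  have "card (patterns \<eta> ?sq) \<le> card (?C \<times> ?H \<times> patterns \<eta> ?st)"
  proof (rule card_patterns_le_labels)
    show "finite (?C \<times> ?H \<times> patterns \<eta> ?st)" by (simp add: finite_patterns)
    show "\<exists>l\<in>?C \<times> ?H \<times> patterns \<eta> ?st. ?lab x l" if x: "x \<in> orbit \<eta>" for x
    proof -
      obtain x' c h where x': "x' \<in> orbit \<eta>" "agree ?sq x x'" "c \<in> ?C" "h \<in> ?H" "broken x' c (c + Q) h"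
        using ex_nearby_break[OF aper x m(1)] by blast
      have "restrict (translate (c - 4 * int m * M, h) x') ?st \<in> patterns \<eta> ?st"
        unfolding patterns_def by (rule imageI[OF translate_in_orbit[OF x'(1)]])
      then show ?thesis using x'
        by (intro bexI[of _ "(c, h, restrict (translate (c - 4 * int m * M, h) x') ?st)"]) auto
    qed
    show "agree ?sq x y"
      if lJ: "l \<in> ?C \<times> ?H \<times> patterns \<eta> ?st" and labx: "?lab x l" and laby: "?lab y l" for x y l
    proof -
      obtain c h w where l: "l = (c, h, w)" by (cases l)
      obtain x' where x': "x' \<in> orbit \<eta>" "agree ?sq x x'" "broken x' c (c + Q) h"
        "restrict (translate (c - 4 * int m * M, h) x') ?st = w" using labx l by auto
      obtain y' where y': "y' \<in> orbit \<eta>" "agree ?sq y y'"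
        "restrict (translate (c - 4 * int m * M, h) y') ?st = w" using laby l by auto
      let ?a = "c - 4 * int m * M"
      have eq: "agree ?st (translate (?a, h) x') (translate (?a, h) y')"
        using x'(4) y'(3) by (simp add: restrict_eq_iff_agree[symmetric])
      have strip: "agree ({?a..?a + int n - 1} \<times> {h..<h + int q}) x' y'"
        unfolding agree_def
      proof clarify
        fix i r assume "i \<in> {?a..?a + int n - 1}" "r \<in> {h..<h + int q}"
        then have "translate (?a, h) x' (i - ?a, r - h) = translate (?a, h) y' (i - ?a, r - h)"
          by (intro eq[unfolded agree_def, rule_format]) auto
        then show "x' (i, r) = y' (i, r)" by simp
      qed
      have "agree ({?a + int m * M..(?a + int n - 1) - int m * M} \<times> {h - int m..<h + int q + int m}) x' y'"
      proof (rule agree_on_cone[OF x'(1) y'(1) strip x'(3)])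
        show "?a + 2 * int m * M \<le> c" using mM M m unfolding assoc by linarith
        show "c + Q \<le> (?a + int n - 1) - 2 * int m * M"
          using n mM M m unfolding assoc by linarith
      qed
      then have "agree ?sq x' y'"
      proof (rule agree_subset)
        have "- (int m + Q) \<le> c" "c \<le> int m + Q" using lJ unfolding l by auto
        then have "?a + int m * M \<le> 0" "int m - 1 \<le> (?a + int n - 1) - int m * M"
          using n mM M m unfolding assoc by linarith+
        then show "?sq \<subseteq> {?a + int m * M..(?a + int n - 1) - int m * M} \<times> {h - int m..<h + int q + int m}"
          using lJ l by auto
      qed
      then show ?thesis using x'(2) y'(2) by (meson agree_sym agree_trans)
    qed
  qed
  also have "\<dots> = nat (2 * (int m + Q) + 1) * (m - q + 1) * card (patterns \<eta> ?st)"
  proof -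
    have "nat (int m - int q + 1) = m - q + 1" using m by simp
    moreover have "nat (int m + Q - - (int m + Q) + 1) = nat (2 * (int m + Q) + 1)" by simp
    ultimately show ?thesis by (simp add: card_cartesian_product algebra_simps)
  qed
  also have "\<dots> \<le> nat (2 * (int m + Q) + 1) * (m + 1) * card (patterns \<eta> ?st)"
    by (intro mult_le_mono) auto
  finally show ?thesis .
qed

end

section \<open>Periodic configurations and polynomial complexity\<close>

lemma rect_complexity_eq_card_patterns:
  "rect_complexity \<eta> n k = card (patterns \<eta> ({0..<int n} \<times> {0..<int k}))"
proof -
  have "lattice_point -` ({0..real n - 1} \<times> {0..real k - 1}) = {0..<int n} \<times> {0..<int k}"
  proof (intro set_eqI)
    fix z :: "int \<times> int"
    have "real_of_int a \<le> real l - 1 \<longleftrightarrow> a < int l" for a l by linarith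
    then show "z \<in> lattice_point -` ({0..real n - 1} \<times> {0..real k - 1}) \<longleftrightarrow>
        z \<in> {0..<int n} \<times> {0..<int k}"
      by (cases z) (simp add: lattice_point_def)
  qed
  then show ?thesis by (simp add: rect_complexity_def pattern_complexity_eq_card_patterns)
qed

text \<open>Otherwise each of the \<open>k\<close> rows adds at least \<open>n\<close> patterns to the single pattern on the empty set,
which gives more than \<open>n * k\<close> of them.\<close>

lemma ex_scarce_row:
  fixes \<eta> :: "int \<times> int \<Rightarrow> 'a::finite"
  assumes "card (patterns \<eta> ({0..<int n} \<times> {0..<int k})) \<le> n * k"
  shows "\<exists>q<k. card (patterns \<eta> ({0..<int n} \<times> {0..<int q + 1}))
    < card (patterns \<eta> ({0..<int n} \<times> {0..<int q})) + n"
proof (rule ccontr)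
  assume neg: "\<not> ?thesis"
  have "n * j < card (patterns \<eta> ({0..<int n} \<times> {0..<int j}))" if "j \<le> k" for j
    using that
  proof (induction j)
    case 0
    then show ?case using card_patterns_pos[of "{}" \<eta>] by simp
  next
    case (Suc j)
    then have "card (patterns \<eta> ({0..<int n} \<times> {0..<int j})) + n
        \<le> card (patterns \<eta> ({0..<int n} \<times> {0..<int j + 1}))"
      using neg by (meson Suc_le_lessD not_le)
    then show ?case using Suc by (simp add: add.commute)
  qed
  from this[of k] assms show False by simp
qed

text \<open>The height \<open>q\<close> comes from a rectangle of minimal height among those at least as wide as high, so that every
such rectangle is higher than \<open>q\<close> and bounds the number of patterns on a strip of height \<open>q\<close> and of its
own width. The widths are unbounded, since only finitely many pairs have \<open>k i \<le> n i \<le> B\<close>.\<close>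

lemma horizontally_periodic_or_polynomial_squares:
  fixes \<eta> :: "int \<times> int \<Rightarrow> 'a::finite" and n k :: "nat \<Rightarrow> nat"
  assumes "inj (\<lambda>i. (n i, k i))"
    and low: "\<And>i. card (patterns \<eta> ({0..<int (n i)} \<times> {0..<int (k i)})) \<le> n i * k i"
    and inf: "infinite {i. k i \<le> n i}"
  shows "(\<exists>Q>0. \<forall>i j. \<eta> (i + Q, j) = \<eta> (i, j)) \<or>
    (\<exists>K. \<forall>m0. \<exists>m\<ge>m0. card (patterns \<eta> ({0..<int m} \<times> {0..<int m})) \<le> K * (m + 1) ^ 4)"
proof -
  obtain i0 where "k i0 \<le> n i0" using inf by (metis (mono_tags, lifting) empty_Collect_eq finite.emptyI)
  then obtain i1 where "k i1 \<le> n i1" and least: "\<And>i. k i \<le> n i \<Longrightarrow> k i1 \<le> k i"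
    using ex_has_least_nat[of "\<lambda>i. k i \<le> n i" i0 k] by blast
  obtain q where q: "q < k i1" and scarce: "card (patterns \<eta> ({0..<int (n i1)} \<times> {0..<int q + 1}))
      < card (patterns \<eta> ({0..<int (n i1)} \<times> {0..<int q})) + n i1"
    using ex_scarce_row[OF low] by blast
  define Q :: int where "Q = fact (n i1) * fact (CARD('a) ^ n i1)"
  define M where "M = Q + 2 * int (n i1)"
  interpret scarce_strip \<eta> "n i1" q Q M
    by unfold_locales (fact scarce Q_def M_def)+
  have Q: "0 < Q" by (rule above.Q_pos)
  show ?thesis
  proof (cases "\<forall>i j. \<eta> (i + Q, j) = \<eta> (i, j)")
    case True
    then show ?thesis using Q by blast
  next
    case False
    then obtain a b where aper: "\<eta> (a + Q, b) \<noteq> \<eta> (a, b)" by blast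
    define \<mu> where "\<mu> = nat M"
    have \<mu>: "int \<mu> = M" "0 < \<mu>" using Q by (simp_all add: \<mu>_def M_def)
    define K where "K = (2 * nat Q + 2) * (64 * \<mu> ^ 2)"
    have "\<exists>m\<ge>m0. card (patterns \<eta> ({0..<int m} \<times> {0..<int m})) \<le> K * (m + 1) ^ 4" for m0
    proof -
      define m1 where "m1 = max m0 (max q 1)"
      obtain i where i: "k i \<le> n i" "8 * \<mu> * m1 < n i"
      proof (rule ccontr)
        assume "\<not> thesis"
        then have "\<forall>i\<in>{i. k i \<le> n i}. n i \<le> 8 * \<mu> * m1" using that not_le by blast
        then have "(\<lambda>i. (n i, k i)) ` {i. k i \<le> n i} \<subseteq> {..8 * \<mu> * m1} \<times> {..8 * \<mu> * m1}"
          by fastforce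
        then have "finite ((\<lambda>i. (n i, k i)) ` {i. k i \<le> n i})"
          by (rule finite_subset) simp
        then show False
          using inf assms(1) by (meson finite_imageD inj_on_subset subset_UNIV)
      qed
      \<comment> \<open>The largest square to which \<open>square_patterns_le\<close> applies with the width \<open>n i\<close>.\<close>
      define m where "m = (n i - 1) div (8 * \<mu>)"
      have "m1 \<le> m" unfolding m_def using i(2) \<mu> by (simp add: less_eq_div_iff_mult_less_eq mult.commute)
      then have m: "m0 \<le> m" "q \<le> m" "0 < m" by (auto simp: m1_def)
      have m_le: "8 * \<mu> * m \<le> n i - 1" unfolding m_def by simp
      have "n i - 1 = 8 * \<mu> * m + (n i - 1) mod (8 * \<mu>)" unfolding m_def by simp
      moreover have "(n i - 1) mod (8 * \<mu>) < 8 * \<mu>" using \<mu> by simp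
      ultimately have n_le: "n i \<le> 8 * \<mu> * (m + 1)" by simp
      have "8 * \<mu> * m < n i" using m_le i(2) by simp
      then have "int (8 * \<mu> * m) < int (n i)" by (simp only: of_nat_less_iff)
      then have "8 * int m * M < int (n i)" by (simp add: \<mu>(1) mult_ac)
      then have "card (patterns \<eta> ({0..<int m} \<times> {0..<int m}))
          \<le> nat (2 * (int m + Q) + 1) * (m + 1) * card (patterns \<eta> ({0..<int (n i)} \<times> {0..<int q}))"
        by (rule square_patterns_le[OF aper m(2,3)])
      also have "\<dots> \<le> ((2 * nat Q + 2) * (m + 1)) * (m + 1) * (64 * \<mu> ^ 2 * (m + 1) ^ 2)"
      proof (intro mult_le_mono order.refl)
        have "nat (2 * (int m + Q) + 1) = 2 * m + 2 * nat Q + 1" using Q by simp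
        then show "nat (2 * (int m + Q) + 1) \<le> (2 * nat Q + 2) * (m + 1)" by simp
        have "card (patterns \<eta> ({0..<int (n i)} \<times> {0..<int q}))
            \<le> card (patterns \<eta> ({0..<int (n i)} \<times> {0..<int (k i)}))"
          by (rule card_patterns_mono) (use least[OF i(1)] q in auto)
        also have "\<dots> \<le> n i * k i" by (rule low)
        also have "\<dots> \<le> (8 * \<mu> * (m + 1)) * (8 * \<mu> * (m + 1))"
          using i(1) n_le by (intro mult_le_mono) auto
        also have "\<dots> = 64 * \<mu> ^ 2 * (m + 1) ^ 2" by algebra
        finally show "card (patterns \<eta> ({0..<int (n i)} \<times> {0..<int q})) \<le> 64 * \<mu> ^ 2 * (m + 1) ^ 2" .
      qed
      also have "\<dots> = K * (m + 1) ^ 4"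
        unfolding K_def by algebra
      finally show ?thesis using m(1) by blast
    qed
    then show ?thesis by blast
  qed
qed

lemma card_patterns_swap_le:
  fixes \<eta> :: "int \<times> int \<Rightarrow> 'a::finite"
  assumes "finite A" "finite B"
  shows "card (patterns (\<eta> \<circ> prod.swap) (A \<times> B)) \<le> card (patterns \<eta> (B \<times> A))"
proof (rule card_patterns_le_labels)
  show "finite (patterns \<eta> (B \<times> A))" by (simp add: finite_patterns assms)
  show "\<exists>l\<in>patterns \<eta> (B \<times> A). restrict (x \<circ> prod.swap) (B \<times> A) = l"
    if x: "x \<in> orbit (\<eta> \<circ> prod.swap)" for x
  proof -
    obtain v where "x = translate v (\<eta> \<circ> prod.swap)" using x by (auto simp: orbit_def)
    then have "x \<circ> prod.swap = translate (prod.swap v) \<eta>" by (cases v) (auto simp: fun_eq_iff)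
    then have "x \<circ> prod.swap \<in> orbit \<eta>" by (simp add: orbit_def)
    then show ?thesis by (simp add: patterns_def)
  qed
  show "agree (A \<times> B) x y"
    if "restrict (x \<circ> prod.swap) (B \<times> A) = l" "restrict (y \<circ> prod.swap) (B \<times> A) = l" for x y l
  proof -
    have "agree (B \<times> A) (x \<circ> prod.swap) (y \<circ> prod.swap)"
      using that by (simp add: restrict_eq_iff_agree[symmetric])
    then show ?thesis by (auto simp: agree_def)
  qed
qed

lemma card_patterns_swap:
  fixes \<eta> :: "int \<times> int \<Rightarrow> 'a::finite"
  assumes "finite A" "finite B"
  shows "card (patterns (\<eta> \<circ> prod.swap) (A \<times> B)) = card (patterns \<eta> (B \<times> A))"
proof (rule antisym)
  have "(\<eta> \<circ> prod.swap) \<circ> prod.swap = \<eta>" by (simp add: fun_eq_iff)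
  then show "card (patterns \<eta> (B \<times> A)) \<le> card (patterns (\<eta> \<circ> prod.swap) (A \<times> B))"
    using card_patterns_swap_le[OF assms(2,1), of "\<eta> \<circ> prod.swap"] by simp
qed (rule card_patterns_swap_le[OF assms])

lemma periodic_or_polynomial_squares:
  fixes \<eta> :: "int \<times> int \<Rightarrow> 'a::finite" and n k :: "nat \<Rightarrow> nat"
  assumes inj: "inj (\<lambda>i. (n i, k i))" and low: "\<And>i. rect_complexity \<eta> (n i) (k i) \<le> n i * k i"
  shows "(\<exists>w. w \<noteq> 0 \<and> (\<forall>z. \<eta> (z + w) = \<eta> z)) \<or>
    (\<exists>K. \<forall>m0. \<exists>m\<ge>m0. card (patterns \<eta> ({0..<int m} \<times> {0..<int m})) \<le> K * (m + 1) ^ 4)"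
proof -
  have "{i. k i \<le> n i} \<union> {i. n i \<le> k i} = UNIV" by auto
  then consider "infinite {i. k i \<le> n i}" | "infinite {i. n i \<le> k i}"
    by (metis finite_Un infinite_UNIV_nat)
  then show ?thesis
  proof cases
    case 1
    have "\<And>i. card (patterns \<eta> ({0..<int (n i)} \<times> {0..<int (k i)})) \<le> n i * k i"
      using low by (simp add: rect_complexity_eq_card_patterns)
    from horizontally_periodic_or_polynomial_squares[OF inj this 1] show ?thesis
    proof
      assume "\<exists>Q>0. \<forall>i j. \<eta> (i + Q, j) = \<eta> (i, j)"
      then obtain Q where "0 < Q" "\<And>i j. \<eta> (i + Q, j) = \<eta> (i, j)" by auto
      then have "(Q, 0) \<noteq> 0 \<and> (\<forall>z. \<eta> (z + (Q, 0)) = \<eta> z)" by (auto simp: zero_prod_def)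
      then show ?thesis by (intro disjI1 exI[of _ "(Q, 0)"])
    qed (rule disjI2)
  next
    case 2
    let ?\<theta> = "\<eta> \<circ> prod.swap"
    have inj': "inj (\<lambda>i. (k i, n i))"
    proof (rule injI)
      fix i j assume "(k i, n i) = (k j, n j)"
      then have "(n i, k i) = (n j, k j)" by simp
      then show "i = j" by (rule injD[OF inj])
    qed
    have "\<And>i. card (patterns ?\<theta> ({0..<int (k i)} \<times> {0..<int (n i)})) \<le> k i * n i"
      using low by (simp add: rect_complexity_eq_card_patterns card_patterns_swap mult.commute)
    from horizontally_periodic_or_polynomial_squares[OF inj' this 2] show ?thesis
    proof
      assume "\<exists>Q>0. \<forall>i j. ?\<theta> (i + Q, j) = ?\<theta> (i, j)"
      then obtain Q where Q: "0 < Q" "\<And>i j. ?\<theta> (i + Q, j) = ?\<theta> (i, j)" by auto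
      have "\<eta> (j, i + Q) = \<eta> (j, i)" for i j using Q(2)[of i j] by simp
      then have "(0, Q) \<noteq> 0 \<and> (\<forall>z. \<eta> (z + (0, Q)) = \<eta> z)" using Q(1) by (auto simp: zero_prod_def)
      then show ?thesis by (intro disjI1 exI[of _ "(0, Q)"])
    next
      assume "\<exists>K. \<forall>m0. \<exists>m\<ge>m0. card (patterns ?\<theta> ({0..<int m} \<times> {0..<int m})) \<le> K * (m + 1) ^ 4"
      then show ?thesis by (simp only: card_patterns_swap finite_atLeastLessThan_int simp_thms)
    qed
  qed
qed

section \<open>Directional entropy and pattern counts\<close>

lemma abs_le_norm_lattice_point:
  "real_of_int \<bar>fst z\<bar> \<le> norm (lattice_point z)" "real_of_int \<bar>snd z\<bar> \<le> norm (lattice_point z)"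
  using norm_fst_le[of "real_of_int (fst z)" "real_of_int (snd z)"]
    norm_snd_le[of "real_of_int (snd z)" "real_of_int (fst z)"]
  by (simp_all add: lattice_point_def)

lemma lattice_point_add: "lattice_point (z + w) = lattice_point z + lattice_point w"
  by (simp add: lattice_point_def)

lemma finite_lattice_points:
  assumes "bounded E"
  shows "finite (lattice_point -` E)"
proof -
  obtain R where R: "\<And>v. v \<in> E \<Longrightarrow> norm v \<le> R" using assms by (auto simp: bounded_iff)
  have "lattice_point -` E \<subseteq> {- \<lceil>R\<rceil>..\<lceil>R\<rceil>} \<times> {- \<lceil>R\<rceil>..\<lceil>R\<rceil>}"
  proof
    fix z assume "z \<in> lattice_point -` E"
    then have "norm (lattice_point z) \<le> R" using R by simp
    then have "real_of_int \<bar>fst z\<bar> \<le> R" "real_of_int \<bar>snd z\<bar> \<le> R"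
      using abs_le_norm_lattice_point[of z] by linarith+
    then have "\<bar>fst z\<bar> \<le> \<lceil>R\<rceil>" "\<bar>snd z\<bar> \<le> \<lceil>R\<rceil>" by (meson le_ceiling_iff ceiling_mono le_of_int_ceiling of_int_le_iff order_trans)+
    then show "z \<in> {- \<lceil>R\<rceil>..\<lceil>R\<rceil>} \<times> {- \<lceil>R\<rceil>..\<lceil>R\<rceil>}" by (cases z) auto
  qed
  then show ?thesis by (rule finite_subset) simp
qed

lemma bounded_thicken:
  assumes "bounded E"
  shows "bounded (thicken t E)"
proof -
  obtain R where R: "\<And>v. v \<in> E \<Longrightarrow> norm v \<le> R" using assms by (auto simp: bounded_iff)
  have "norm v \<le> R + t" if v: "v \<in> thicken t E" for v
  proof -
    obtain w where "w \<in> E" "norm (v - w) < t" using v by (auto simp: thicken_def)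
    then show ?thesis using R[of w] norm_triangle_ineq2[of v w] by linarith
  qed
  then show ?thesis unfolding bounded_iff by blast
qed

lemma thicken_thicken_subset: "thicken r (thicken t E) \<subseteq> thicken (t + r) E"
proof
  fix v assume "v \<in> thicken r (thicken t E)"
  then obtain w w' where w: "w' \<in> E" "norm (v - w) < r" "norm (w - w') < t"
    by (auto simp: thicken_def)
  have "norm (v - w') \<le> norm (v - w) + norm (w - w')"
    using norm_triangle_ineq[of "v - w" "w - w'"] by simp
  then show "v \<in> thicken (t + r) E" using w by (auto simp: thicken_def intro!: bexI[of _ w'])
qed

lemma pattern_complexity_mono:
  fixes \<eta> :: "int \<times> int \<Rightarrow> 'a::finite"
  assumes "E \<subseteq> F" "bounded F"
  shows "pattern_complexity \<eta> E \<le> pattern_complexity \<eta> F"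
  unfolding pattern_complexity_eq_card_patterns
  using assms by (intro card_patterns_mono finite_lattice_points) auto

lemma pattern_complexity_pos:
  fixes \<eta> :: "int \<times> int \<Rightarrow> 'a::finite"
  assumes "bounded E"
  shows "0 < pattern_complexity \<eta> E"
  unfolding pattern_complexity_eq_card_patterns
  by (rule card_patterns_pos) (rule finite_lattice_points[OF assms])

lemma orbit_subset_orbit_closure: "orbit \<eta> \<subseteq> orbit_closure \<eta>"
  unfolding orbit_closure_def orbit_def by (rule closure_of_subset) auto

text \<open>Prescribing the values on a finite set is an open condition in the product topology.\<close>

lemma orbit_closure_approx:
  assumes x: "x \<in> orbit_closure \<eta>" and "finite S"
  shows "\<exists>x'\<in>orbit \<eta>. agree S x x'"
proof -
  let ?U = "\<Pi>\<^sub>E z\<in>UNIV. if z \<in> S then {x z} else UNIV"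
  have "openin (product_topology (\<lambda>_. discrete_topology UNIV) UNIV) ?U"
  proof (rule product_topology_basis)
    have "{i. (if i \<in> S then {x i} else UNIV) \<noteq> topspace (discrete_topology UNIV)} \<subseteq> S" by auto
    then show "finite {i. (if i \<in> S then {x i} else UNIV) \<noteq> topspace (discrete_topology UNIV)}"
      by (rule finite_subset) fact
  qed simp
  moreover have "x \<in> ?U" by (auto simp: PiE_iff)
  ultimately obtain x' where "x' \<in> orbit \<eta>" "x' \<in> ?U"
    using x unfolding orbit_closure_def in_closure_of orbit_def by blast
  moreover have "agree S x x'" unfolding agree_def
  proof
    fix z assume "z \<in> S"
    have "x' z \<in> (if z \<in> S then {x z} else UNIV)"
      by (rule PiE_mem[OF \<open>x' \<in> ?U\<close>]) simp
    with \<open>z \<in> S\<close> show "x z = x' z" by simp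
  qed
  ultimately show ?thesis by blast
qed

lemma config_dist_less:
  assumes "0 < \<epsilon>" "2 powr - r < \<epsilon>" and "\<And>z. norm (lattice_point z) < r \<Longrightarrow> x z = y z"
  shows "config_dist x y < \<epsilon>"
proof (cases "x = y")
  case False
  then have "{z. x z \<noteq> y z} \<noteq> {}" by auto
  moreover have "r \<le> norm (lattice_point z)" if "x z \<noteq> y z" for z
    using assms(3)[of z] that by linarith
  ultimately have "r \<le> (INF z\<in>{z. x z \<noteq> y z}. norm (lattice_point z))"
    by (intro cINF_greatest) auto
  then have "2 powr - (INF z\<in>{z. x z \<noteq> y z}. norm (lattice_point z)) \<le> 2 powr - r" by simp
  then have "2 powr - (INF z\<in>{z. x z \<noteq> y z}. norm (lattice_point z)) < \<epsilon>"
    using assms(2) by (rule le_less_trans)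
  then show ?thesis using False by (simp only: config_dist_def if_False)
qed (simp add: config_dist_def assms(1))

text \<open>Two configurations are close along \<open>E\<close> as soon as they agree on all lattice points within distance
\<open>r\<close> of \<open>E\<close>; one translate of \<open>\<eta>\<close> for each pattern there is a spanning set.\<close>

lemma spanning_number_le:
  fixes \<eta> :: "int \<times> int \<Rightarrow> 'a::finite"
  assumes E: "bounded E" and "0 < \<epsilon>" "2 powr - r < \<epsilon>"
  shows "spanning_number (orbit_closure \<eta>) E \<epsilon> \<le> pattern_complexity \<eta> (thicken r E)"
proof -
  let ?S = "lattice_point -` thicken r E"
  have finS: "finite ?S" by (intro finite_lattice_points bounded_thicken E)
  define rep where "rep w = (SOME x. x \<in> orbit \<eta> \<and> restrict x ?S = w)" for w
  have rep: "rep w \<in> orbit \<eta> \<and> restrict (rep w) ?S = w" if w_pat: "w \<in> patterns \<eta> ?S" for w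
  proof -
    have "\<exists>x. x \<in> orbit \<eta> \<and> restrict x ?S = w" using w_pat by (auto simp: patterns_def)
    then show ?thesis unfolding rep_def by (rule someI_ex)
  qed
  let ?Y = "rep ` patterns \<eta> ?S"
  have "spanning_set (orbit_closure \<eta>) E \<epsilon> ?Y" unfolding spanning_set_def
  proof (intro conjI ballI)
    show "?Y \<subseteq> orbit_closure \<eta>" using rep orbit_subset_orbit_closure by blast
    fix x assume "x \<in> orbit_closure \<eta>"
    then obtain x' where x': "x' \<in> orbit \<eta>" "agree ?S x x'" using orbit_closure_approx finS by blast
    let ?w = "restrict x' ?S"
    have w: "?w \<in> patterns \<eta> ?S" using x' by (simp add: patterns_def)
    have "agree ?S x' (rep ?w)" using rep[OF w] by (simp add: restrict_eq_iff_agree[symmetric])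
    then have agr: "agree ?S x (rep ?w)" using agree_trans x'(2) by blast
    show "\<exists>y\<in>?Y. \<forall>n. lattice_point n \<in> E \<longrightarrow> config_dist (translate n x) (translate n y) < \<epsilon>"
    proof (intro bexI allI impI)
      fix n assume n: "lattice_point n \<in> E"
      show "config_dist (translate n x) (translate n (rep ?w)) < \<epsilon>"
      proof (rule config_dist_less[OF assms(2,3)])
        fix z assume "norm (lattice_point z) < r"
        then have "z + n \<in> ?S" using n by (auto simp: thicken_def lattice_point_add intro!: bexI[of _ "lattice_point n"])
        then show "translate n x z = translate n (rep ?w) z" using agr by (simp add: agree_def)
      qed
    qed (use w in blast)
  qed
  moreover have fin: "finite (patterns \<eta> ?S)" by (rule finite_patterns[OF finS])
  ultimately have "spanning_number (orbit_closure \<eta>) E \<epsilon> \<le> card ?Y"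
    unfolding spanning_number_def by (intro Least_le) blast
  also have "\<dots> \<le> card (patterns \<eta> ?S)" by (rule card_image_le[OF fin])
  finally show ?thesis by (simp add: pattern_complexity_eq_card_patterns)
qed

text \<open>Passing from the resolution \<open>\<epsilon>\<close> to pattern counts only widens the neighbourhood of the segment by
a constant, so the upper limit is \<open>0\<close> already for each fixed \<open>\<epsilon>\<close> and \<open>t\<close>.\<close>

lemma directional_entropy_eq_0:
  fixes \<eta> :: "int \<times> int \<Rightarrow> 'a::finite"
  assumes sub: "\<And>\<rho> \<delta>. 0 < \<rho> \<Longrightarrow> 0 < \<delta> \<Longrightarrow>
    eventually (\<lambda>s. ln (real (pattern_complexity \<eta> (thicken \<rho> (closed_segment 0 (s *\<^sub>R u))))) \<le> \<delta> * s) at_top"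
  shows "directional_entropy (orbit_closure \<eta>) u = 0"
proof -
  let ?g = "\<lambda>\<epsilon> t s. ln (real (spanning_number (orbit_closure \<eta>) (thicken t (closed_segment 0 (s *\<^sub>R u))) \<epsilon>)) / s"
  have Limsup_0: "Limsup at_top (\<lambda>s. ereal (?g \<epsilon> t s)) = 0" if \<epsilon>: "0 < \<epsilon>" and t: "0 < t" for \<epsilon> t :: real
  proof (rule antisym)
    obtain r where r: "0 < r" "2 powr - r < \<epsilon>"
    proof -
      have "((\<lambda>r. 2 powr - r) \<longlongrightarrow> (0::real)) at_top" by real_asymp
      then have "eventually (\<lambda>r. 2 powr - r < \<epsilon>) at_top" using \<epsilon> by (rule order_tendstoD)
      then have "eventually (\<lambda>r. 0 < r \<and> 2 powr - r < \<epsilon>) at_top"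
        using eventually_gt_at_top[of 0] by eventually_elim blast
      then obtain r where "0 < r" "2 powr - r < \<epsilon>"
        using eventually_happens'[OF trivial_limit_at_top_linorder] by blast
      then show thesis by (rule that)
    qed
    show "Limsup at_top (\<lambda>s. ereal (?g \<epsilon> t s)) \<le> 0"
    proof (rule ereal_le_epsilon2)
      fix \<delta> :: real assume \<delta>: "0 < \<delta>"
      have "eventually (\<lambda>s. ereal (?g \<epsilon> t s) \<le> ereal \<delta>) at_top"
        using sub[OF add_pos_pos[OF t r(1)] \<delta>] eventually_gt_at_top[of 0]
      proof eventually_elim
        case (elim s)
        let ?I = "closed_segment 0 (s *\<^sub>R u)" and ?n = "spanning_number (orbit_closure \<eta>) (thicken t (closed_segment 0 (s *\<^sub>R u))) \<epsilon>"
        have bdd: "bounded ?I" by (rule bounded_closed_segment)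
        have "?n \<le> pattern_complexity \<eta> (thicken r (thicken t ?I))"
          by (rule spanning_number_le[OF bounded_thicken[OF bdd] \<epsilon> r(2)])
        also have "\<dots> \<le> pattern_complexity \<eta> (thicken (t + r) ?I)"
          by (rule pattern_complexity_mono[OF thicken_thicken_subset bounded_thicken[OF bdd]])
        finally have le: "?n \<le> pattern_complexity \<eta> (thicken (t + r) ?I)" .
        have "ln (real ?n) \<le> ln (real (pattern_complexity \<eta> (thicken (t + r) ?I)))"
        proof (cases "?n = 0")
          case True
          then show ?thesis using pattern_complexity_pos[OF bounded_thicken[OF bdd], of \<eta> "t + r"] by simp
        qed (use le in simp)
        then show ?case using elim t r \<delta> by (simp add: divide_le_eq)
      qed
      then have "Limsup at_top (\<lambda>s. ereal (?g \<epsilon> t s)) \<le> ereal \<delta>" by (rule Limsup_bounded)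
      then show "Limsup at_top (\<lambda>s. ereal (?g \<epsilon> t s)) \<le> 0 + ereal \<delta>" by simp
    qed
    have "eventually (\<lambda>s. 0 \<le> ereal (?g \<epsilon> t s)) at_top"
      using eventually_gt_at_top[of 0]
    proof eventually_elim
      case (elim s)
      have "0 \<le> ln (real m)" for m :: nat by (cases "m = 0") auto
      then show ?case using elim by simp
    qed
    then show "0 \<le> Limsup at_top (\<lambda>s. ereal (?g \<epsilon> t s))"
      by (intro le_Limsup) simp_all
  qed
  have "eventually (\<lambda>\<epsilon>. (SUP t\<in>{0<..}. Limsup at_top (\<lambda>s. ereal (?g \<epsilon> t s))) = 0) (at_right 0)"
    using eventually_at_right_less[of 0]
  proof eventually_elim
    case (elim \<epsilon>)
    then have "(SUP t\<in>{0<..}. Limsup at_top (\<lambda>s. ereal (?g \<epsilon> t s))) = (SUP t\<in>{0::real<..}. 0)"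
      by (intro SUP_cong) (auto simp: Limsup_0)
    then show ?case by simp
  qed
  then have "((\<lambda>\<epsilon>. SUP t\<in>{0<..}. Limsup at_top (\<lambda>s. ereal (?g \<epsilon> t s))) \<longlongrightarrow> 0) (at_right 0)"
    by (rule tendsto_eventually)
  then show ?thesis unfolding directional_entropy_def
    by (intro tendsto_Lim) (simp_all add: trivial_limit_at_right_real)
qed

lemma ln_of_nat_mono: "0 < a \<Longrightarrow> a \<le> b \<Longrightarrow> ln (real a) \<le> ln (real b)"
  by simp

text \<open>The segment is cut into pieces of length \<open>\<sigma> = m / 2 - \<rho> - 1\<close>, chosen so that the \<open>\<rho>\<close>-neighbourhood of each
piece fits into a lattice square of side \<open>m\<close>. Each piece contributes at most
\<open>ln (K * (m + 1) ^ 4)\<close>, which for large \<open>m\<close> is a small multiple of \<open>\<sigma>\<close>.\<close>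

lemma eventually_complexity_le_of_squares:
  fixes \<eta> :: "int \<times> int \<Rightarrow> 'a::finite" and u :: "real \<times> real"
  assumes u: "norm u = 1" and poly: "\<And>m0. \<exists>m\<ge>m0. card (patterns \<eta> ({0..<int m} \<times> {0..<int m})) \<le> K * (m + 1) ^ 4"
    and \<rho>: "0 < \<rho>" and \<delta>: "0 < \<delta>"
  shows "eventually (\<lambda>s. ln (real (pattern_complexity \<eta> (thicken \<rho> (closed_segment 0 (s *\<^sub>R u))))) \<le> \<delta> * s) at_top"
proof -
  have "((\<lambda>m. (ln (real K) + 4 * ln (real m + 1)) / (real m / 2 - \<rho> - 1)) \<longlongrightarrow> 0) at_top"
    by real_asymp
  then have "eventually (\<lambda>m. (ln (real K) + 4 * ln (real m + 1)) / (real m / 2 - \<rho> - 1) < \<delta> / 2) at_top"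
    by (rule order_tendstoD) (use \<delta> in simp)
  then obtain m0 where m0: "\<And>m. m0 \<le> m \<Longrightarrow> (ln (real K) + 4 * ln (real m + 1)) / (real m / 2 - \<rho> - 1) < \<delta> / 2"
    by (auto simp: eventually_at_top_linorder)
  obtain m where m: "max m0 (nat \<lceil>2 * \<rho> + 3\<rceil>) \<le> m"
    and cm: "card (patterns \<eta> ({0..<int m} \<times> {0..<int m})) \<le> K * (m + 1) ^ 4"
    using poly by blast
  let ?sq = "{0..<int m} \<times> {0..<int m}"
  define D where "D = card (patterns \<eta> ?sq)"
  define \<sigma> where "\<sigma> = real m / 2 - \<rho> - 1"
  have \<sigma>: "0 < \<sigma>"
  proof -
    have "2 * \<rho> + 3 \<le> real m" using m by linarith
    then show ?thesis by (simp add: \<sigma>_def)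
  qed
  have D: "0 < D" unfolding D_def by (rule card_patterns_pos) simp
  have K: "0 < K" using D cm unfolding D_def by (cases K) auto
  have "ln (real D) \<le> ln (real (K * (m + 1) ^ 4))" using D cm unfolding D_def by (rule ln_of_nat_mono)
  also have "\<dots> = ln (real K) + 4 * ln (real m + 1)" using K by (simp add: ln_mult ln_realpow add.commute)
  also have "\<dots> \<le> \<delta> / 2 * \<sigma>" using m0[of m] m \<sigma> unfolding \<sigma>_def[symmetric] by (simp add: divide_less_eq)
  finally have lnD: "ln (real D) \<le> \<delta> / 2 * \<sigma>" .
  show ?thesis using eventually_ge_at_top[of \<sigma>]
  proof eventually_elim
    case (elim s)
    let ?I = "closed_segment 0 (s *\<^sub>R u)"
    define corner where "corner k = (\<lceil>real k * \<sigma> * fst u - \<sigma> - \<rho>\<rceil>, \<lceil>real k * \<sigma> * snd u - \<sigma> - \<rho>\<rceil>)" for k :: nat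
    define J where "J = {..nat \<lfloor>s / \<sigma>\<rfloor>}"
    have cover: "lattice_point -` thicken \<rho> ?I \<subseteq> (\<Union>k\<in>J. (\<lambda>z. z + corner k) ` ?sq)"
    proof
      fix z assume "z \<in> lattice_point -` thicken \<rho> ?I"
      then obtain w where w: "w \<in> ?I" "norm (lattice_point z - w) < \<rho>" by (auto simp: thicken_def)
      then obtain c where c: "0 \<le> c" "c \<le> 1" "w = (c * s) *\<^sub>R u"
        by (auto simp: in_segment)
      define \<tau> where "\<tau> = c * s"
      have \<tau>: "0 \<le> \<tau>" "\<tau> \<le> s" using c elim \<sigma> by (simp_all add: \<tau>_def mult_left_le_one_le)
      define k where "k = nat \<lfloor>\<tau> / \<sigma>\<rfloor>"
      have "0 \<le> \<tau> / \<sigma>" using \<tau> \<sigma> by simp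
      then have "real k \<le> \<tau> / \<sigma>" "\<tau> / \<sigma> < real k + 1" unfolding k_def by linarith+
      then have k: "real k * \<sigma> \<le> \<tau>" "\<tau> < real k * \<sigma> + \<sigma>" using \<sigma> by (simp_all add: field_simps)
      have "\<tau> / \<sigma> \<le> s / \<sigma>" using \<tau> \<sigma> by (simp add: divide_right_mono)
      then have "k \<in> J" unfolding J_def k_def by (auto intro!: nat_mono floor_mono)
      have "norm (lattice_point z - (real k * \<sigma>) *\<^sub>R u) \<le> norm (lattice_point z - w) + norm (w - (real k * \<sigma>) *\<^sub>R u)"
        using norm_triangle_ineq[of "lattice_point z - w" "w - (real k * \<sigma>) *\<^sub>R u"] by simp
      also have "norm (w - (real k * \<sigma>) *\<^sub>R u) = \<bar>\<tau> - real k * \<sigma>\<bar>"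
        unfolding c(3) \<tau>_def[symmetric] scaleR_left_diff_distrib[symmetric] by (simp add: u)
      also have "\<dots> \<le> \<sigma>" using k by linarith
      finally have near: "norm (lattice_point z - (real k * \<sigma>) *\<^sub>R u) < \<rho> + \<sigma>" using w by linarith
      have "\<bar>fst (lattice_point z - (real k * \<sigma>) *\<^sub>R u)\<bar> < \<rho> + \<sigma>"
        "\<bar>snd (lattice_point z - (real k * \<sigma>) *\<^sub>R u)\<bar> < \<rho> + \<sigma>"
        using near norm_fst_le[of "fst (lattice_point z - (real k * \<sigma>) *\<^sub>R u)" "snd (lattice_point z - (real k * \<sigma>) *\<^sub>R u)"]
          norm_snd_le[of "snd (lattice_point z - (real k * \<sigma>) *\<^sub>R u)" "fst (lattice_point z - (real k * \<sigma>) *\<^sub>R u)"]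
        unfolding prod.collapse real_norm_def by linarith+
      then have "\<bar>real_of_int (fst z) - real k * \<sigma> * fst u\<bar> < \<rho> + \<sigma>" "\<bar>real_of_int (snd z) - real k * \<sigma> * snd u\<bar> < \<rho> + \<sigma>"
        by (simp_all add: lattice_point_def)
      then have "z - corner k \<in> ?sq"
        unfolding corner_def \<sigma>_def by (cases z) (auto, linarith+)
      then have "z \<in> (\<lambda>z. z + corner k) ` ?sq" by (intro image_eqI[of _ _ "z - corner k"]) auto
      then show "z \<in> (\<Union>k\<in>J. (\<lambda>z. z + corner k) ` ?sq)" using \<open>k \<in> J\<close> by blast
    qed
    have "pattern_complexity \<eta> (thicken \<rho> ?I) \<le> card (patterns \<eta> (\<Union>k\<in>J. (\<lambda>z. z + corner k) ` ?sq))"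
      unfolding pattern_complexity_eq_card_patterns by (rule card_patterns_mono[OF cover]) (simp add: J_def)
    also have "\<dots> \<le> D ^ card J"
      by (rule card_patterns_UN_le) (simp_all add: J_def D_def card_patterns_translate_le)
    finally have "ln (real (pattern_complexity \<eta> (thicken \<rho> ?I))) \<le> ln (real (D ^ card J))"
      by (rule ln_of_nat_mono[OF pattern_complexity_pos[OF bounded_thicken[OF bounded_closed_segment]]])
    also have "\<dots> = real (card J) * ln (real D)" using D by (simp add: ln_realpow)
    also have "\<dots> \<le> (s / \<sigma> + 1) * (\<delta> / 2 * \<sigma>)"
    proof (rule mult_mono)
      have "0 \<le> s / \<sigma>" using elim \<sigma> by simp
      then show "real (card J) \<le> s / \<sigma> + 1" unfolding J_def by simp
      show "0 \<le> s / \<sigma> + 1" using elim \<sigma> by simp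
      show "0 \<le> ln (real D)" using D by simp
    qed (rule lnD)
    also have "\<dots> = \<delta> / 2 * (s + \<sigma>)" using \<sigma> by (simp add: field_simps)
    also have "\<dots> \<le> \<delta> * s" using elim \<delta> by simp
    finally show ?case .
  qed
qed

section \<open>Configurations with a period\<close>

lemma orbit_periodic:
  assumes "\<forall>z. \<eta> (z + w) = \<eta> z" and "x \<in> orbit \<eta>"
  shows "\<forall>z. x (z + w) = x z"
proof -
  obtain v where "x = translate v \<eta>" using assms(2) by (auto simp: orbit_def)
  then show ?thesis using assms(1)[rule_format, of "z + v" for z] by (simp add: ac_simps)
qed

lemma orbit_closure_periodic:
  assumes "\<forall>z. \<eta> (z + w) = \<eta> z" and "x \<in> orbit_closure \<eta>"
  shows "\<forall>z. x (z + w) = x z"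
proof
  fix z
  obtain x' where "x' \<in> orbit \<eta>" "agree {z, z + w} x x'"
    using orbit_closure_approx[OF assms(2), of "{z, z + w}"] by auto
  then show "x (z + w) = x z" using orbit_periodic[OF assms(1), of x'] by (simp add: agree_def)
qed

lemma periodic_int_multiple:
  fixes x :: "int \<times> int \<Rightarrow> 'a"
  assumes "\<forall>z. x (z + w) = x z"
  shows "x (z + (k * fst w, k * snd w)) = x z"
proof (induction k rule: int_induct[of _ 0])
  case base
  then show ?case by (simp add: zero_prod_def[symmetric])
next
  case (step1 k)
  have "z + ((k + 1) * fst w, (k + 1) * snd w) = (z + (k * fst w, k * snd w)) + w"
    by (cases w; cases z) (simp add: algebra_simps)
  then show ?case using step1 assms by metis
next
  case (step2 k)
  have "z + (k * fst w, k * snd w) = (z + ((k - 1) * fst w, (k - 1) * snd w)) + w"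
    by (cases w; cases z) (simp add: algebra_simps)
  then show ?case using step2 assms by metis
qed

lemma lattice_point_multiple: "lattice_point (k * fst w, k * snd w) = real_of_int k *\<^sub>R lattice_point w"
  by (simp add: lattice_point_def)

lemma parallel_unit_vector:
  fixes u v :: "real \<times> real"
  assumes u: "norm u = 1" and cross: "fst u * snd v = snd u * fst v"
  obtains c where "v = c *\<^sub>R u"
proof -
  define c where "c = fst v * fst u + snd v * snd u"
  have u2: "fst u * fst u + snd u * snd u = 1"
    using u by (simp add: norm_prod_def power2_eq_square)
  have "c * fst u = fst v * (fst u * fst u) + (fst u * snd v) * snd u"
    by (simp add: c_def algebra_simps)
  also have "\<dots> = fst v * (fst u * fst u + snd u * snd u)" unfolding cross by (simp add: algebra_simps)
  finally have "fst v = c * fst u" by (simp add: u2)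
  moreover have "c * snd u = (snd u * fst v) * fst u + snd v * (snd u * snd u)"
    by (simp add: c_def algebra_simps)
  then have "c * snd u = snd v * (fst u * fst u + snd u * snd u)"
    unfolding cross[symmetric] by (simp add: algebra_simps)
  then have "snd v = c * snd u" by (simp add: u2)
  ultimately show ?thesis by (intro that[of c]) (simp add: prod_eq_iff)
qed

text \<open>The line through \<open>z\<close> in the direction of the period \<open>w\<close> meets the given line; the translate of
\<open>z\<close> by the integral multiple of \<open>w\<close> just before the intersection lies within distance \<open>norm w\<close> of it, and
each element of the orbit closure takes there the same value as at \<open>z\<close>.\<close>

lemma expansive_line_of_transversal_period:
  assumes per: "\<forall>z. \<eta> (z + w) = \<eta> z" and u: "norm u = 1"
    and transversal: "fst u * snd (lattice_point w) \<noteq> snd u * fst (lattice_point w)"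
  shows "expansive_line (orbit_closure \<eta>) (range (\<lambda>c. c *\<^sub>R u))"
  unfolding expansive_line_def
proof (intro exI conjI ballI impI)
  let ?W = "lattice_point w" and ?l = "range (\<lambda>c. c *\<^sub>R u)"
  show "0 < norm ?W + 1" using norm_ge_zero[of ?W] by linarith
  fix x y assume x: "x \<in> orbit_closure \<eta>" and y: "y \<in> orbit_closure \<eta>"
    and eq: "\<forall>n. infdist (lattice_point n) ?l < norm ?W + 1 \<longrightarrow> x n = y n"
  show "x = y"
  proof
    fix z
    let ?Z = "lattice_point z" and ?d = "fst u * snd ?W - snd u * fst ?W"
    define s where "s = - (fst u * snd ?Z - snd u * fst ?Z) / ?d"
    define p where "p = ?Z + s *\<^sub>R ?W"
    have cross: "fst u * snd p = snd u * fst p"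
      using transversal by (simp add: p_def s_def field_simps)
    obtain c where "p = c *\<^sub>R u" using parallel_unit_vector[OF u cross] .
    then have p: "p \<in> ?l" by blast
    let ?k = "\<lfloor>s\<rfloor>"
    let ?z = "z + (?k * fst w, ?k * snd w)"
    have "infdist (lattice_point ?z) ?l \<le> dist (lattice_point ?z) p" by (rule infdist_le[OF p])
    also have "lattice_point ?z - p = (real_of_int ?k - s) *\<^sub>R ?W"
      by (simp only: lattice_point_add lattice_point_multiple p_def) (simp add: algebra_simps)
    then have "dist (lattice_point ?z) p = \<bar>real_of_int ?k - s\<bar> * norm ?W" by (simp add: dist_norm)
    also have "\<dots> \<le> 1 * norm ?W" by (rule mult_right_mono[OF _ norm_ge_zero]) linarith
    finally have "infdist (lattice_point ?z) ?l < norm ?W + 1" by simp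
    then have "x ?z = y ?z" using eq by blast
    then show "x z = y z"
      using periodic_int_multiple[OF orbit_closure_periodic[OF per x], of z ?k]
        periodic_int_multiple[OF orbit_closure_periodic[OF per y], of z ?k] by metis
  qed
qed

text \<open>A multiple of the period brings each point near the segment to a point near the origin.\<close>

lemma complexity_le_of_parallel_period:
  fixes \<eta> :: "int \<times> int \<Rightarrow> 'a::finite"
  assumes per: "\<forall>z. \<eta> (z + w) = \<eta> z" and w: "lattice_point w = c *\<^sub>R u" "c \<noteq> 0" and u: "norm u = 1"
  shows "pattern_complexity \<eta> (thicken \<rho> (closed_segment 0 (s *\<^sub>R u))) \<le> pattern_complexity \<eta> (ball 0 (\<rho> + \<bar>c\<bar>))"
  unfolding pattern_complexity_eq_card_patterns
proof (rule card_patterns_le)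
  show "finite (lattice_point -` ball 0 (\<rho> + \<bar>c\<bar>))" by (intro finite_lattice_points bounded_ball)
  fix x y assume x: "x \<in> orbit \<eta>" and y: "y \<in> orbit \<eta>" and agr: "agree (lattice_point -` ball 0 (\<rho> + \<bar>c\<bar>)) x y"
  show "agree (lattice_point -` thicken \<rho> (closed_segment 0 (s *\<^sub>R u))) x y"
    unfolding agree_def
  proof
    fix z assume "z \<in> lattice_point -` thicken \<rho> (closed_segment 0 (s *\<^sub>R u))"
    then obtain v where v: "v \<in> closed_segment 0 (s *\<^sub>R u)" "norm (lattice_point z - v) < \<rho>"
      by (auto simp: thicken_def)
    then obtain t where t: "v = t *\<^sub>R u" by (auto simp: in_segment)
    define k where "k = \<lfloor>t / c\<rfloor>"
    let ?z = "z + (- k * fst w, - k * snd w)"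
    have "lattice_point ?z = (lattice_point z - v) + (t - real_of_int k * c) *\<^sub>R u"
      unfolding lattice_point_add lattice_point_multiple w(1) t by (simp add: algebra_simps)
    then have "norm (lattice_point ?z) \<le> norm (lattice_point z - v) + \<bar>t - real_of_int k * c\<bar>"
      using norm_triangle_ineq[of "lattice_point z - v" "(t - real_of_int k * c) *\<^sub>R u"] by (simp add: u)
    also have "\<bar>t - real_of_int k * c\<bar> = \<bar>t / c - real_of_int k\<bar> * \<bar>c\<bar>"
      using w(2) by (simp add: abs_mult[symmetric] algebra_simps)
    also have "\<dots> \<le> 1 * \<bar>c\<bar>" unfolding k_def by (intro mult_right_mono) linarith+
    finally have "norm (lattice_point ?z) < \<rho> + \<bar>c\<bar>" using v by linarith
    then have "x ?z = y ?z" using agr by (simp add: agree_def)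
    then show "x z = y z"
      using periodic_int_multiple[OF orbit_periodic[OF per x], of z "- k"]
        periodic_int_multiple[OF orbit_periodic[OF per y], of z "- k"] by metis
  qed
qed

section \<open>Entropy along nonexpansive directions\<close>

theorem corollary1p3:
  fixes \<eta> :: "int \<times> int \<Rightarrow> 'a::finite"
    and n k :: "nat \<Rightarrow> nat"
    and u :: "real \<times> real"
  assumes "inj (\<lambda>i. (n i, k i))"
    and "\<And>i. n i > 0" and "\<And>i. k i > 0"
    and "\<And>i. rect_complexity \<eta> (n i) (k i) \<le> n i * k i"
    and "norm u = 1"
    and "\<not> expansive_line (orbit_closure \<eta>) (range (\<lambda>c. c *\<^sub>R u))"
  shows "directional_entropy (orbit_closure \<eta>) u = 0"
proof (rule directional_entropy_eq_0)
  fix \<rho> \<delta> :: real assume \<rho>: "0 < \<rho>" and \<delta>: "0 < \<delta>"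
  let ?L = "\<lambda>s. ln (real (pattern_complexity \<eta> (thicken \<rho> (closed_segment 0 (s *\<^sub>R u)))))"
  from periodic_or_polynomial_squares[OF assms(1,4)]
  show "eventually (\<lambda>s. ?L s \<le> \<delta> * s) at_top"
  proof
    assume "\<exists>w. w \<noteq> 0 \<and> (\<forall>z. \<eta> (z + w) = \<eta> z)"
    then obtain w where w: "w \<noteq> 0" and per: "\<forall>z. \<eta> (z + w) = \<eta> z" by blast
    have "lattice_point w \<noteq> 0" using w by (cases w) (auto simp: lattice_point_def zero_prod_def)
    moreover have "fst u * snd (lattice_point w) = snd u * fst (lattice_point w)"
      using expansive_line_of_transversal_period[OF per assms(5)] assms(6) by blast
    ultimately obtain c where c: "c \<noteq> 0" "lattice_point w = c *\<^sub>R u"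
      using parallel_unit_vector[OF assms(5)] by (metis scaleR_zero_left)
    define B where "B = pattern_complexity \<eta> (ball 0 (\<rho> + \<bar>c\<bar>))"
    show ?thesis using eventually_ge_at_top[of "ln (real B) / \<delta>"]
    proof eventually_elim
      case (elim s)
      have "?L s \<le> ln (real B)"
        unfolding B_def
        using complexity_le_of_parallel_period[OF per c(2,1) assms(5), of \<rho> s]
          pattern_complexity_pos[OF bounded_thicken[OF bounded_closed_segment], of \<eta> \<rho> 0 "s *\<^sub>R u"]
        by simp
      also have "\<dots> \<le> \<delta> * s" using elim \<delta> by (simp add: divide_le_eq mult.commute)
      finally show ?case .
    qed
  next
    assume "\<exists>K. \<forall>m0. \<exists>m\<ge>m0. card (patterns \<eta> ({0..<int m} \<times> {0..<int m})) \<le> K * (m + 1) ^ 4"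
    then obtain K where "\<And>m0. \<exists>m\<ge>m0. card (patterns \<eta> ({0..<int m} \<times> {0..<int m})) \<le> K * (m + 1) ^ 4"
      by blast
    then show ?thesis by (rule eventually_complexity_le_of_squares[OF assms(5) _ \<rho> \<delta>])
  qed
qed

end
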